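(* Let $1 \leq a \leq b \leq c$ be integers with $(a,b) \neq (1,2)$, and suppose $c \geq d = \max(4,ab)$. Then $\left|\mathcal{F}(K_{a,b,c})\right| = \left|\mathcal{F}(K_{a,b,d})\right|$.
   Context: All graphs are finite, undirected and simple, and are considered up to isomorphism. $K_{a,b,c}$ denotes the complete tripartite graph with parts of sizes $a,b,c$. A Triangle-Y ($\nabla Y$) move on a graph takes a 3-cycle with vertices $x,y,z$, deletes the edges $xy,yz,zx$, and adds a new vertex $v$ with edges $xv,yv,zv$. A Y-Triangle ($Y\nabla$) move is the inverse operation: for a vertex $v$ of degree three whose neighbours $x,y,z$ are pairwise non-adjacent, delete $v$ and add the edges $xy,yz,zx$. Two graphs are cousins if one is obtained from the other by a sequence of zero or more $\nabla Y$ and $Y\nabla$ moves. The family $\mathcal{F}(G)$ is the set of (isomorphism classes of) cousins of $G$, and $|\mathcal{F}(G)|$ is its size. *)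

theory Defs
  imports Main
begin

type_synonym 'a graph = "'a set \<times> 'a set set"

abbreviation verts :: "'a graph \<Rightarrow> 'a set" where "verts \<equiv> fst"
abbreviation edges :: "'a graph \<Rightarrow> 'a set set" where "edges \<equiv> snd"

definition simple_graph :: "'a graph \<Rightarrow> bool" where
  "simple_graph G \<longleftrightarrow> finite (verts G) \<and> (\<forall>e\<in>edges G. e \<subseteq> verts G \<and> card e = 2)"

definition neighbours :: "'a graph \<Rightarrow> 'a \<Rightarrow> 'a set" where
  "neighbours G v = {u. {v, u} \<in> edges G}"

definition graph_iso :: "'a graph \<Rightarrow> 'b graph \<Rightarrow> bool" where
  "graph_iso G H \<longleftrightarrow> (\<exists>f. bij_betw f (verts G) (verts H) \<and> edges H = (`) f ` edges G)"

definition triangle_Y :: "'a graph \<Rightarrow> 'a graph \<Rightarrow> bool" where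
  "triangle_Y G H \<longleftrightarrow>
     (\<exists>x y z v. {x, y} \<in> edges G \<and> {y, z} \<in> edges G \<and> {z, x} \<in> edges G \<and> v \<notin> verts G \<and>
        H = (insert v (verts G),
             (edges G - {{x, y}, {y, z}, {z, x}}) \<union> {{x, v}, {y, v}, {z, v}}))"

definition Y_triangle :: "'a graph \<Rightarrow> 'a graph \<Rightarrow> bool" where
  "Y_triangle G H \<longleftrightarrow>
     (\<exists>x y z v. v \<in> verts G \<and> neighbours G v = {x, y, z} \<and> card {x, y, z} = 3 \<and>
        {x, y} \<notin> edges G \<and> {y, z} \<notin> edges G \<and> {z, x} \<notin> edges G \<and>
        H = (verts G - {v},
             (edges G - {{x, v}, {y, v}, {z, v}}) \<union> {{x, y}, {y, z}, {z, x}}))"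

definition cousin :: "'a graph \<Rightarrow> 'a graph \<Rightarrow> bool" where
  "cousin G H \<longleftrightarrow> (\<exists>H'. (\<lambda>A B. triangle_Y A B \<or> Y_triangle A B)\<^sup>*\<^sup>* G H' \<and> graph_iso H' H)"

text \<open>Isomorphism classes are formed among simple graphs with vertices in \<open>nat\<close>: every finite
  graph has such a copy, and a new vertex for a Triangle-Y move is always available.\<close>

definition iso_rel :: "(nat graph \<times> nat graph) set" where
  "iso_rel = {(G, H). simple_graph G \<and> simple_graph H \<and> graph_iso G H}"

definition family :: "nat graph \<Rightarrow> nat graph set set" where
  "family G = {H. simple_graph H \<and> cousin G H} // iso_rel"

text \<open>The parts are \<open>{0..<a}\<close>, \<open>{a..<a+b}\<close> and \<open>{a+b..<a+b+c}\<close>.\<close>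

definition complete_tripartite :: "nat \<Rightarrow> nat \<Rightarrow> nat \<Rightarrow> nat graph" where
  "complete_tripartite a b c =
     ({0..<a+b+c},
      {{i, j} | i j. i \<in> {0..<a} \<and> j \<in> {a..<a+b}} \<union>
      {{i, j} | i j. i \<in> {0..<a} \<and> j \<in> {a+b..<a+b+c}} \<union>
      {{i, j} | i j. i \<in> {a..<a+b} \<and> j \<in> {a+b..<a+b+c}})"

lemma simple_complete_tripartite: "simple_graph (complete_tripartite a b c)"
  by (auto simp: simple_graph_def complete_tripartite_def card_insert_if)

lemma simple_graphD:
  assumes "simple_graph G" "{x, y} \<in> edges G"
  shows "x \<noteq> y" "x \<in> verts G" "y \<in> verts G"
  using assms by (fastforce simp: simple_graph_def)+

lemma finite_edges:
  assumes "simple_graph G"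
  shows "finite (edges G)"
  using assms by (intro finite_subset[of "edges G" "Pow (verts G)"]) (auto simp: simple_graph_def)

lemma triangle_Y_simple:
  assumes "simple_graph G" "triangle_Y G H"
  shows "simple_graph H"
proof -
  obtain x y z v where *: "{x, y} \<in> edges G" "{y, z} \<in> edges G" "{z, x} \<in> edges G"
    and v: "v \<notin> verts G"
    and H: "H = (insert v (verts G), (edges G - {{x, y}, {y, z}, {z, x}}) \<union> {{x, v}, {y, v}, {z, v}})"
    using assms(2) by (auto simp: triangle_Y_def)
  note d = simple_graphD[OF assms(1) *(1)] simple_graphD[OF assms(1) *(2)]
  show ?thesis using assms(1) v d by (auto simp: H simple_graph_def card_2_iff doubleton_eq_iff)
qed

lemma Y_triangle_iff_triangle_Y:
  assumes "simple_graph G" "simple_graph H"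
  shows "Y_triangle G H \<longleftrightarrow> triangle_Y H G"
proof
  assume "Y_triangle G H"
  then obtain x y z v where v: "v \<in> verts G" and n: "neighbours G v = {x, y, z}"
    and c: "card {x, y, z} = 3" and ne: "{x, y} \<notin> edges G" "{y, z} \<notin> edges G" "{z, x} \<notin> edges G"
    and H: "H = (verts G - {v}, (edges G - {{x, v}, {y, v}, {z, v}}) \<union> {{x, y}, {y, z}, {z, x}})"
    by (auto simp: Y_triangle_def)
  have e: "{x, v} \<in> edges G" "{y, v} \<in> edges G" "{z, v} \<in> edges G"
    using n by (auto simp: neighbours_def insert_commute)
  have d: "x \<noteq> v" "y \<noteq> v" "z \<noteq> v" using simple_graphD[OF assms(1)] e by auto
  have "edges G = (edges H - {{x, y}, {y, z}, {z, x}}) \<union> {{x, v}, {y, v}, {z, v}}"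
    using e ne d by (auto simp: H)
  moreover have "verts G = insert v (verts H)" using v by (auto simp: H)
  ultimately have "G = (insert v (verts H),
      (edges H - {{x, y}, {y, z}, {z, x}}) \<union> {{x, v}, {y, v}, {z, v}})"
    by (metis prod.collapse)
  moreover have "{x, y} \<in> edges H" "{y, z} \<in> edges H" "{z, x} \<in> edges H" "v \<notin> verts H"
    by (auto simp: H)
  ultimately show "triangle_Y H G" unfolding triangle_Y_def by blast
next
  assume "triangle_Y H G"
  then obtain x y z v where e: "{x, y} \<in> edges H" "{y, z} \<in> edges H" "{z, x} \<in> edges H"
    and v: "v \<notin> verts H"
    and G: "G = (insert v (verts H), (edges H - {{x, y}, {y, z}, {z, x}}) \<union> {{x, v}, {y, v}, {z, v}})"
    by (auto simp: triangle_Y_def)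
  note d = simple_graphD[OF assms(2) e(1)] simple_graphD[OF assms(2) e(2)]
    simple_graphD[OF assms(2) e(3)]
  have dv: "x \<noteq> v" "y \<noteq> v" "z \<noteq> v" using d v by auto
  have nv: "w \<notin> edges H" if "v \<in> w" for w
    using that v assms(2) by (auto simp: simple_graph_def)
  have "neighbours G v = {x, y, z}"
    using nv by (auto simp: neighbours_def G doubleton_eq_iff)
  moreover have "card {x, y, z} = 3" using d by auto
  moreover have "{x, y} \<notin> edges G" "{y, z} \<notin> edges G" "{z, x} \<notin> edges G"
    using dv by (auto simp: G doubleton_eq_iff)
  moreover have "edges H = (edges G - {{x, v}, {y, v}, {z, v}}) \<union> {{x, y}, {y, z}, {z, x}}"
    using e nv by (auto simp: G)
  moreover have "verts H = verts G - {v}" using v by (auto simp: G)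
  moreover have "v \<in> verts G" by (simp add: G)
  ultimately show "Y_triangle G H" unfolding Y_triangle_def by (metis prod.collapse)
qed

lemma Y_triangle_simple:
  assumes "simple_graph G" "Y_triangle G H"
  shows "simple_graph H"
proof -
  obtain x y z v where v: "v \<in> verts G" and n: "neighbours G v = {x, y, z}"
    and c: "card {x, y, z} = 3"
    and H: "H = (verts G - {v}, (edges G - {{x, v}, {y, v}, {z, v}}) \<union> {{x, y}, {y, z}, {z, x}})"
    using assms(2) by (auto simp: Y_triangle_def)
  have e: "{v, x} \<in> edges G" "{v, y} \<in> edges G" "{v, z} \<in> edges G"
    using n by (auto simp: neighbours_def)
  note d = simple_graphD[OF assms(1) e(1)] simple_graphD[OF assms(1) e(2)]
    simple_graphD[OF assms(1) e(3)]
  have xyz: "x \<noteq> y" "y \<noteq> z" "z \<noteq> x"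
    using c by (auto simp: card_insert_if split: if_splits)
  have "w \<subseteq> verts G - {v} \<and> card w = 2" if w: "w \<in> edges H" for w
  proof (cases "w \<in> {{x, y}, {y, z}, {z, x}}")
    case True
    then show ?thesis using d xyz by auto
  next
    case False
    then have wE: "w \<in> edges G" and wn: "w \<notin> {{x, v}, {y, v}, {z, v}}" using w by (auto simp: H)
    then have w2: "w \<subseteq> verts G" "card w = 2" using assms(1) by (auto simp: simple_graph_def)
    have "v \<notin> w"
    proof
      assume "v \<in> w"
      then obtain u where "w = {v, u}" using w2(2) by (auto simp: card_2_iff)
      then show False using wE wn n by (auto simp: neighbours_def insert_commute)
    qed
    then show ?thesis using w2 by auto
  qed
  then show ?thesis using assms(1) by (simp add: simple_graph_def H)
qed

lemma triangle_Y_invariants: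
  assumes "simple_graph G" "triangle_Y G H"
  shows "card (edges H) = card (edges G)"
    and "verts H - \<Union> (edges H) = verts G - \<Union> (edges G)"
proof -
  obtain x y z v where e: "{x, y} \<in> edges G" "{y, z} \<in> edges G" "{z, x} \<in> edges G"
    and v: "v \<notin> verts G"
    and H: "H = (insert v (verts G), (edges G - {{x, y}, {y, z}, {z, x}}) \<union> {{x, v}, {y, v}, {z, v}})"
    using assms(2) by (auto simp: triangle_Y_def)
  note d = simple_graphD[OF assms(1) e(1)] simple_graphD[OF assms(1) e(2)]
    simple_graphD[OF assms(1) e(3)]
  have nv: "v \<notin> w" if "w \<in> edges G" for w
    using that v assms(1) by (auto simp: simple_graph_def)
  have fin: "finite (edges G)" by (rule finite_edges[OF assms(1)])
  have c3: "card {{x, y}, {y, z}, {z, x}} = 3" "card {{x, v}, {y, v}, {z, v}} = 3"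
    using d v by (auto simp: doubleton_eq_iff card_insert_if)
  have "card (edges H) = card (edges G - {{x, y}, {y, z}, {z, x}}) + card {{x, v}, {y, v}, {z, v}}"
    using fin nv by (subst card_Un_disjoint[symmetric]) (auto simp: H)
  also have "\<dots> = card (edges G) - 3 + 3"
    using e c3 by (subst card_Diff_subset) auto
  also have "card {{x, y}, {y, z}, {z, x}} \<le> card (edges G)"
    using e fin by (intro card_mono) auto
  then have "card (edges G) - 3 + 3 = card (edges G)" using c3(1) by linarith
  finally show "card (edges H) = card (edges G)" .
  show "verts H - \<Union> (edges H) = verts G - \<Union> (edges G)"
    using e v by (auto simp: H)
qed

lemma iso_rel_equiv: "equiv {G. simple_graph G} iso_rel"
proof (rule equivI)
  show "iso_rel \<subseteq> {G. simple_graph G} \<times> {G. simple_graph G}" by (auto simp: iso_rel_def)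
  show "refl_on {G. simple_graph G} iso_rel"
    by (auto simp: refl_on_def iso_rel_def graph_iso_def intro!: exI[of _ id])
  show "sym iso_rel"
  proof (rule symI)
    fix G H assume "(G, H) \<in> iso_rel"
    then obtain f where s: "simple_graph G" "simple_graph H"
      and f: "bij_betw f (verts G) (verts H)" "edges H = (`) f ` edges G"
      by (auto simp: iso_rel_def graph_iso_def)
    let ?g = "inv_into (verts G) f"
    have "?g ` f ` e = e" if "e \<in> edges G" for e
      using that s(1) f(1) by (intro inv_into_image_cancel) (auto simp: bij_betw_def simple_graph_def)
    then have "edges G = (`) ?g ` edges H" by (force simp: f(2) image_image)
    then show "(H, G) \<in> iso_rel"
      using s bij_betw_inv_into[OF f(1)] by (auto simp: iso_rel_def graph_iso_def)
  qed
  show "trans iso_rel"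
  proof (rule transI)
    fix G H K assume "(G, H) \<in> iso_rel" "(H, K) \<in> iso_rel"
    then obtain f g where s: "simple_graph G" "simple_graph K"
      and f: "bij_betw f (verts G) (verts H)" "edges H = (`) f ` edges G"
      and g: "bij_betw g (verts H) (verts K)" "edges K = (`) g ` edges H"
      by (auto simp: iso_rel_def graph_iso_def)
    have "edges K = (`) (g \<circ> f) ` edges G" by (auto simp: f g image_image image_comp)
    then show "(G, K) \<in> iso_rel"
      using s bij_betw_trans[OF f(1) g(1)] by (auto simp: iso_rel_def graph_iso_def)
  qed
qed

text \<open>The number of edges and the set of isolated vertices are invariant under both moves, so a
  family is finite and its cardinality is not the default value for infinite sets.\<close>

lemma finite_family:
  assumes G: "simple_graph G"
  shows "finite (family G)"
proof -
  define I where "I = verts G - \<Union> (edges G)"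
  define m where "m = card (edges G)"
  define N where "N = card I + 2 * m"
  have step: "simple_graph H \<and> card (edges H) = m \<and> verts H - \<Union> (edges H) = I"
    if "(\<lambda>A B. triangle_Y A B \<or> Y_triangle A B)\<^sup>*\<^sup>* G H" for H
    using that
  proof induction
    case base
    then show ?case using G by (simp add: I_def m_def)
  next
    case (step A B)
    then show ?case
      by (metis triangle_Y_simple Y_triangle_simple triangle_Y_invariants Y_triangle_iff_triangle_Y)
  qed
  let ?B = "Pow {..<N} \<times> Pow (Pow {..<N})"
  have "family G \<subseteq> (\<lambda>H. iso_rel `` {H}) ` ?B"
  proof
    fix C assume "C \<in> family G"
    then obtain H H' where C: "C = iso_rel `` {H}" and H: "simple_graph H"
      and H': "(\<lambda>A B. triangle_Y A B \<or> Y_triangle A B)\<^sup>*\<^sup>* G H'" "graph_iso H' H"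
      by (auto simp: family_def quotient_def cousin_def)
    have s: "simple_graph H'" "card (edges H') = m" "verts H' - \<Union> (edges H') = I"
      using step[OF H'(1)] by auto
    have HH: "(H', H) \<in> iso_rel" using s H H'(2) by (simp add: iso_rel_def)
    have finV: "finite (verts H')" using s(1) by (simp add: simple_graph_def)
    have "card (verts H') \<le> card (I \<union> \<Union> (edges H'))"
      using s(1) finV by (intro card_mono) (auto simp: s(3)[symmetric] simple_graph_def intro: finite_subset)
    also have "\<dots> \<le> card I + card (\<Union> (edges H'))" by (rule card_Un_le)
    also have "card (\<Union> (edges H')) \<le> (\<Sum>e\<in>edges H'. card e)"
      by (rule card_Union_le_sum_card)
    also have "\<dots> = 2 * m" using s(1,2) by (simp add: simple_graph_def)
    finally have le: "card (verts H') \<le> N" by (simp add: N_def)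
    obtain f where f: "bij_betw f (verts H') {0..<card (verts H')}"
      using ex_bij_betw_finite_nat[OF finV] by blast
    define K where "K = (f ` verts H', (`) f ` edges H')"
    have inj: "inj_on f (verts H')" using f by (simp add: bij_betw_def)
    have img: "f ` verts H' \<subseteq> {..<N}" using f le by (auto simp: bij_betw_def)
    have "card (f ` e) = 2" if "e \<in> edges H'" for e
      using that s(1) inj by (metis card_image inj_on_subset simple_graph_def)
    then have "simple_graph K" using s(1) by (auto simp: K_def simple_graph_def)
    moreover have "graph_iso H' K"
      using inj by (auto simp: K_def graph_iso_def bij_betw_def intro!: exI[of _ f])
    ultimately have "(H', K) \<in> iso_rel" using s(1) by (simp add: iso_rel_def)
    then have "C = iso_rel `` {K}"
      using C HH equiv_class_eq[OF iso_rel_equiv] by metis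
    moreover have "K \<in> ?B"
      using img s(1) by (auto simp: K_def simple_graph_def)
    ultimately show "C \<in> (\<lambda>H. iso_rel `` {H}) ` ?B" by blast
  qed
  then show ?thesis by (rule finite_subset) simp
qed

end

theory Submission
  imports
    Defs
    "HOL-Library.Ramsey"
    "HOL-Library.Infinite_Typeclass"
    "HOL-Combinatorics.Permutations"
begin

text \<open>Let \<open>A\<close>, \<open>B\<close>, \<open>C\<close> be the parts of \<open>K_{a,b,c}\<close> and \<open>S = A \<union> B\<close>. Both moves preserve the
  number of components of \<open>G - S\<close> that are adjacent to all of \<open>S\<close>; this uses \<open>|S| \<noteq> 3\<close>, i.e.
  \<open>(a, b) \<noteq> (1, 2)\<close>. So every cousin of \<open>K_{a,b,c}\<close> has \<open>c\<close> of them, and vertices of \<open>S\<close>, having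
  degree at least \<open>c \<ge> 4\<close>, are never removed. Such a component accounts for at least \<open>|S|\<close> edges,
  and for more unless it is a single vertex with neighbourhood \<open>S\<close>; since the number \<open>ab + (a + b)c\<close>
  of edges is invariant, a cousin of \<open>K_{a,b,c+1}\<close> with \<open>c \<ge> ab\<close> always has a vertex with
  neighbourhood \<open>S\<close>. Deleting it yields a cousin of \<open>K_{a,b,c}\<close>, and adding it is the inverse
  operation.

  On isomorphism classes this is well defined because \<open>S\<close> is determined by the cousin: any other
  set with the same component count could be followed back along the moves to \<open>K_{a,b,c}\<close>, where
  only \<open>A \<union> B\<close> qualifies, except for \<open>a = 1\<close>, \<open>b = c\<close>, where \<open>A \<union> C\<close> does too. In that case the
  cousins are obtained from edge-disjoint triangles through the vertex of \<open>A\<close>, and their number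
  determines the isomorphism type.\<close>

subsection \<open>Images of graphs\<close>

lemma simple_graph_iff_nsets: "simple_graph G \<longleftrightarrow> finite (verts G) \<and> edges G \<subseteq> [verts G]\<^bsup>2\<^esup>"
proof -
  have "[verts G]\<^bsup>2\<^esup> = {e. e \<subseteq> verts G \<and> card e = 2}"
    unfolding nsets_def by (metis card.infinite zero_neq_numeral)
  then show ?thesis by (auto simp: simple_graph_def)
qed

lemma graph_eqI:
  assumes "simple_graph G" "simple_graph H" "verts G = verts H"
    and "\<And>p q. {p, q} \<in> edges G \<longleftrightarrow> {p, q} \<in> edges H"
  shows "G = H"
proof -
  have "card e = 2" if "e \<in> edges G \<or> e \<in> edges H" for e
    using that assms(1,2) by (auto simp: simple_graph_def)
  then have "\<exists>p q. e = {p, q}" if "e \<in> edges G \<or> e \<in> edges H" for e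
    using that by (meson card_2_iff)
  then have "edges G = edges H" using assms(4) by blast
  then show ?thesis using assms(3) by (simp add: prod_eq_iff)
qed

lemma neighbours_subset_verts: "simple_graph G \<Longrightarrow> neighbours G p \<subseteq> verts G - {p}"
  by (auto simp: neighbours_def dest: simple_graphD)

lemma neighbours_commute: "q \<in> neighbours G p \<longleftrightarrow> p \<in> neighbours G q"
  by (simp add: neighbours_def insert_commute)

definition map_graph :: "('a \<Rightarrow> 'b) \<Rightarrow> 'a graph \<Rightarrow> 'b graph" where
  "map_graph h G = (h ` verts G, (`) h ` edges G)"

lemma verts_map_graph [simp]: "verts (map_graph h G) = h ` verts G"
  and edges_map_graph [simp]: "edges (map_graph h G) = (`) h ` edges G"
  by (simp_all add: map_graph_def)

lemma map_graph_id [simp]: "map_graph id G = G"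
  by (simp add: map_graph_def)

lemma map_graph_comp: "map_graph g (map_graph h G) = map_graph (g \<circ> h) G"
  by (simp add: map_graph_def image_comp)

lemma map_graph_cong:
  assumes "simple_graph G" "\<And>x. x \<in> verts G \<Longrightarrow> g x = h x"
  shows "map_graph g G = map_graph h G"
proof -
  have "g ` e = h ` e" if "e \<in> edges G" for e
    using that assms by (intro image_cong) (auto simp: simple_graph_def)
  then show ?thesis using assms(2) by (simp add: map_graph_def cong: image_cong)
qed

lemma map_graph_inv_into:
  assumes "simple_graph G" "inj_on h (verts G)"
  shows "map_graph (inv_into (verts G) h) (map_graph h G) = G"
proof -
  have "map_graph (inv_into (verts G) h) (map_graph h G) = map_graph id G"
    unfolding map_graph_comp using assms by (intro map_graph_cong) auto
  then show ?thesis by simp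
qed

lemma image_nsets: "inj_on h A \<Longrightarrow> (`) h ` [A]\<^bsup>n\<^esup> = [h ` A]\<^bsup>n\<^esup>"
  using bij_betw_nsets[of h A "h ` A" n] by (simp add: bij_betw_def)

lemma simple_map_graph:
  assumes "simple_graph G" "inj_on h (verts G)"
  shows "simple_graph (map_graph h G)"
  using assms image_nsets[OF assms(2), of 2] by (auto simp: simple_graph_iff_nsets)

lemma edge_map_graph_iff:
  assumes "simple_graph G" "inj_on h (verts G)" "p \<in> verts G" "q \<in> verts G"
  shows "{h p, h q} \<in> edges (map_graph h G) \<longleftrightarrow> {p, q} \<in> edges G"
proof -
  have "h ` {p, q} \<in> (`) h ` edges G \<longleftrightarrow> {p, q} \<in> edges G"
    using assms by (intro inj_on_image_mem_iff[OF inj_on_image_Pow]) (auto simp: simple_graph_def)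
  then show ?thesis by simp
qed

lemma neighbours_map_graph:
  assumes "simple_graph G" "inj_on h (verts G)" "p \<in> verts G"
  shows "neighbours (map_graph h G) (h p) = h ` neighbours G p"
proof -
  have "neighbours (map_graph h G) (h p) \<subseteq> h ` verts G"
    using neighbours_subset_verts[OF simple_map_graph[OF assms(1,2)]] by auto
  moreover have "h q \<in> neighbours (map_graph h G) (h p) \<longleftrightarrow> q \<in> neighbours G p" if "q \<in> verts G" for q
    using edge_map_graph_iff[OF assms that] by (simp add: neighbours_def)
  ultimately show ?thesis using neighbours_subset_verts[OF assms(1)] by blast
qed

lemma fresh_vertex:
  fixes G H :: "'a::infinite graph"
  assumes "simple_graph G" "simple_graph H"
  obtains f where "f \<notin> verts G" "f \<notin> verts H"
proof -
  have "finite (verts G \<union> verts H)" using assms by (simp add: simple_graph_def)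
  then show ?thesis using that arb_element by blast
qed

subsection \<open>Simultaneous Triangle-Y moves\<close>

definition star :: "'a \<Rightarrow> 'a set \<Rightarrow> 'a set set" where
  "star f S = (\<lambda>s. {f, s}) ` S"

lemma doubleton_in_star_iff: "{p, q} \<in> star f S \<longleftrightarrow> p = f \<and> q \<in> S \<or> q = f \<and> p \<in> S"
  by (auto simp: star_def doubleton_eq_iff)

lemma image_star: "(`) h ` star f S = star (h f) (h ` S)"
  by (simp add: star_def image_image)

definition replace_triangles :: "'a graph \<Rightarrow> 'a set \<Rightarrow> ('a \<Rightarrow> 'a set) \<Rightarrow> 'a graph" where
  "replace_triangles G Y \<tau> =
     (verts G \<union> Y, (edges G - (\<Union>y\<in>Y. [\<tau> y]\<^bsup>2\<^esup>)) \<union> (\<Union>y\<in>Y. star y (\<tau> y)))"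

abbreviation replace_triangle :: "'a graph \<Rightarrow> 'a \<Rightarrow> 'a set \<Rightarrow> 'a graph" where
  "replace_triangle G v T \<equiv> replace_triangles G {v} (\<lambda>_. T)"

lemma verts_replace_triangles [simp]: "verts (replace_triangles G Y \<tau>) = verts G \<union> Y"
  by (simp add: replace_triangles_def)

definition triangle :: "'a graph \<Rightarrow> 'a set \<Rightarrow> bool" where
  "triangle G T \<longleftrightarrow> card T = 3 \<and> [T]\<^bsup>2\<^esup> \<subseteq> edges G"

lemma triangle_edge: "triangle G T \<Longrightarrow> p \<in> T \<Longrightarrow> q \<in> T \<Longrightarrow> p \<noteq> q \<Longrightarrow> {p, q} \<in> edges G"
  by (auto simp: triangle_def)

lemma triangle_otherE:
  assumes "triangle G T"
  obtains q where "q \<in> T" "q \<noteq> p"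
proof -
  have "T \<noteq> {}" "T \<noteq> {p}" using assms by (auto simp: triangle_def)
  then show ?thesis using that by blast
qed

lemma triangle_subset_verts:
  assumes "simple_graph G" "triangle G T"
  shows "T \<subseteq> verts G"
proof
  fix p assume p_in: "p \<in> T"
  obtain q where "q \<in> T" "q \<noteq> p" using triangle_otherE[OF assms(2)] .
  then show "p \<in> verts G"
    using simple_graphD(2)[OF assms(1)] triangle_edge[OF assms(2) p_in] by blast
qed

lemma triangle_map_graph:
  assumes "simple_graph G" "inj_on h (verts G)" "triangle G T"
  shows "triangle (map_graph h G) (h ` T)"
proof -
  have "inj_on h T" using inj_on_subset[OF assms(2) triangle_subset_verts[OF assms(1,3)]] .
  then show ?thesis
    using assms(3) image_mono[of "[T]\<^bsup>2\<^esup>" "edges G" "(`) h"]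
    by (simp add: triangle_def card_image image_nsets)
qed

lemma map_graph_replace_triangles:
  assumes "simple_graph G" "inj_on h (verts G)"
    and \<tau>: "\<And>y. y \<in> Y \<Longrightarrow> \<tau> y \<subseteq> verts G" "\<And>y. y \<in> Y \<Longrightarrow> \<tau>' (h y) = h ` \<tau> y"
  shows "map_graph h (replace_triangles G Y \<tau>) = replace_triangles (map_graph h G) (h ` Y) \<tau>'"
proof -
  have "(`) h ` (edges G - (\<Union>y\<in>Y. [\<tau> y]\<^bsup>2\<^esup>)) = (`) h ` edges G - (`) h ` (\<Union>y\<in>Y. [\<tau> y]\<^bsup>2\<^esup>)"
    using assms(1) \<tau>(1)
    by (intro inj_on_image_set_diff[OF inj_on_image_Pow[OF assms(2)]])
      (auto simp: simple_graph_def nsets_def)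
  also have "(`) h ` (\<Union>y\<in>Y. [\<tau> y]\<^bsup>2\<^esup>) = (\<Union>y\<in>Y. [h ` \<tau> y]\<^bsup>2\<^esup>)"
    using image_nsets[OF inj_on_subset[OF assms(2) \<tau>(1)]] by (simp add: image_UN)
  finally have "(`) h ` (edges G - (\<Union>y\<in>Y. [\<tau> y]\<^bsup>2\<^esup>)) = (`) h ` edges G - (\<Union>y\<in>Y. [h ` \<tau> y]\<^bsup>2\<^esup>)" .
  then show ?thesis
    using \<tau>(2) by (simp add: map_graph_def replace_triangles_def image_Un image_UN image_star)
qed

locale triangle_packing =
  fixes G :: "'a graph" and Y :: "'a set" and \<tau> :: "'a \<Rightarrow> 'a set"
  assumes simple: "simple_graph G"
    and finite_new: "finite Y"
    and new: "Y \<inter> verts G = {}"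
    and triangles: "\<And>y. y \<in> Y \<Longrightarrow> triangle G (\<tau> y)"
    and edge_disjoint: "\<And>y z. y \<in> Y \<Longrightarrow> z \<in> Y \<Longrightarrow> y \<noteq> z \<Longrightarrow> [\<tau> y]\<^bsup>2\<^esup> \<inter> [\<tau> z]\<^bsup>2\<^esup> = {}"
begin

lemma triangle_subset: "y \<in> Y \<Longrightarrow> \<tau> y \<subseteq> verts G"
  by (rule triangle_subset_verts[OF simple triangles])

lemma triangle_not_new: "y \<in> Y \<Longrightarrow> z \<in> Y \<Longrightarrow> z \<notin> \<tau> y"
  using triangle_subset new by blast

lemma neighbours_replaced_new:
  assumes "y \<in> Y"
  shows "neighbours (replace_triangles G Y \<tau>) y = \<tau> y"
proof -
  have "{y, u} \<notin> edges G" for u using simple_graphD(2)[OF simple] new assms by blast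
  then show ?thesis
    using assms triangle_not_new
    by (auto simp: neighbours_def replace_triangles_def doubleton_in_star_iff)
qed

lemma edge_replaced_old_iff:
  assumes "p \<notin> Y" "q \<notin> Y"
  shows "{p, q} \<in> edges (replace_triangles G Y \<tau>) \<longleftrightarrow>
    {p, q} \<in> edges G \<and> (\<forall>y\<in>Y. \<not> {p, q} \<subseteq> \<tau> y)"
  using assms simple_graphD(1)[OF simple]
  by (auto simp: replace_triangles_def doubleton_in_star_iff)

lemma simple_replaced: "simple_graph (replace_triangles G Y \<tau>)"
proof -
  have "edges G \<subseteq> [verts G \<union> Y]\<^bsup>2\<^esup>"
    using simple nsets_mono[of "verts G" "verts G \<union> Y" 2] by (auto simp: simple_graph_iff_nsets)
  moreover have "star y (\<tau> y) \<subseteq> [verts G \<union> Y]\<^bsup>2\<^esup>" if "y \<in> Y" for y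
    using that triangle_subset[OF that] triangle_not_new[OF that that] by (auto simp: star_def)
  ultimately show ?thesis
    using simple finite_new by (auto simp: replace_triangles_def simple_graph_iff_nsets)
qed

lemma edges_original:
  "edges G = (edges (replace_triangles G Y \<tau>) - (\<Union>y\<in>Y. star y (\<tau> y))) \<union> (\<Union>y\<in>Y. [\<tau> y]\<^bsup>2\<^esup>)"
proof -
  have "edges G \<inter> star y (\<tau> y) = {}" if "y \<in> Y" for y
    using that new simple_graphD[OF simple] by (auto simp: star_def)
  moreover have "[\<tau> y]\<^bsup>2\<^esup> \<subseteq> edges G" if "y \<in> Y" for y
    using triangles[OF that] by (simp add: triangle_def)
  ultimately show ?thesis by (auto simp: replace_triangles_def)
qed

end

lemma replace_triangles_inject:
  assumes "triangle_packing G Y \<tau>" "triangle_packing H Y \<tau>"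
    and "replace_triangles G Y \<tau> = replace_triangles H Y \<tau>"
  shows "G = H"
proof (rule prod_eqI)
  have "verts G \<union> Y = verts H \<union> Y"
    using arg_cong[OF assms(3), of verts] by simp
  then show "verts G = verts H"
    using triangle_packing.new[OF assms(1)] triangle_packing.new[OF assms(2)] by blast
  show "edges G = edges H"
    using assms(1,2)[THEN triangle_packing.edges_original] assms(3) by simp
qed

lemma triangle_packing_singleton:
  "triangle_packing G {v} (\<lambda>_. T) \<longleftrightarrow> simple_graph G \<and> v \<notin> verts G \<and> triangle G T"
  by (auto simp: triangle_packing_def)

lemma triangle_Y_iff:
  assumes "simple_graph G"
  shows "triangle_Y G H \<longleftrightarrow>
    (\<exists>v T. triangle_packing G {v} (\<lambda>_. T) \<and> H = replace_triangle G v T)"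
proof
  assume "triangle_Y G H"
  then obtain x y z v where triangle_edges: "{x, y} \<in> edges G" "{y, z} \<in> edges G" "{z, x} \<in> edges G"
    and v_new: "v \<notin> verts G"
    and H_eq: "H = (insert v (verts G),
      (edges G - {{x, y}, {y, z}, {z, x}}) \<union> {{x, v}, {y, v}, {z, v}})"
    by (auto simp: triangle_Y_def)
  have distinct: "x \<noteq> y" "y \<noteq> z" "z \<noteq> x" using simple_graphD(1)[OF assms] triangle_edges by auto
  then have pairs_T: "[{x, y, z}]\<^bsup>2\<^esup> = {{x, y}, {y, z}, {z, x}}"
    by (auto simp: nsets_2_eq insert_commute)
  have "H = replace_triangle G v {x, y, z}"
    by (simp add: H_eq replace_triangles_def pairs_T star_def insert_commute)
  moreover have "triangle G {x, y, z}"
    using triangle_edges distinct pairs_T by (simp add: triangle_def)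
  ultimately show "\<exists>v T. triangle_packing G {v} (\<lambda>_. T) \<and> H = replace_triangle G v T"
    using assms v_new triangle_packing_singleton by metis
next
  assume "\<exists>v T. triangle_packing G {v} (\<lambda>_. T) \<and> H = replace_triangle G v T"
  then obtain v T where v_new: "v \<notin> verts G"
    and triangle_T: "triangle G T" and H_eq: "H = replace_triangle G v T"
    by (auto simp: triangle_packing_singleton)
  obtain x y z where T_eq: "T = {x, y, z}" "x \<noteq> y" "y \<noteq> z" "z \<noteq> x"
    using triangle_T by (auto simp: triangle_def card_3_iff)
  then have "[T]\<^bsup>2\<^esup> = {{x, y}, {y, z}, {z, x}}"
    by (auto simp: nsets_2_eq insert_commute)
  then have "{x, y} \<in> edges G" "{y, z} \<in> edges G" "{z, x} \<in> edges G"
    and "H = (insert v (verts G), (edges G - {{x, y}, {y, z}, {z, x}}) \<union> {{x, v}, {y, v}, {z, v}})"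
    using triangle_T
    by (simp_all add: triangle_def H_eq replace_triangles_def star_def T_eq(1) insert_commute)
  then show "triangle_Y G H" unfolding triangle_Y_def using v_new by blast
qed

lemma triangle_Y_map_graph:
  assumes "simple_graph G" "triangle_Y G H" "inj_on h (verts H)"
  shows "triangle_Y (map_graph h G) (map_graph h H)"
proof -
  obtain v T where packing: "triangle_packing G {v} (\<lambda>_. T)" and H_eq: "H = replace_triangle G v T"
    using assms(1,2) triangle_Y_iff by blast
  then have v_new: "v \<notin> verts G" and triangle_T: "triangle G T"
    by (simp_all add: triangle_packing_singleton)
  have inj: "inj_on h (verts G)" "h v \<notin> h ` verts G"
    using assms(3) v_new by (simp_all add: H_eq)
  have "triangle_packing (map_graph h G) {h v} (\<lambda>_. h ` T)"
    unfolding triangle_packing_singleton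
    using simple_map_graph[OF assms(1) inj(1)] triangle_map_graph[OF assms(1) inj(1) triangle_T]
      inj(2) by simp
  moreover have "map_graph h H = replace_triangle (map_graph h G) (h v) (h ` T)"
    unfolding H_eq using triangle_packing.triangle_subset[OF packing] inj(1) assms(1)
    by (subst map_graph_replace_triangles) auto
  ultimately show ?thesis
    using triangle_Y_iff[OF simple_map_graph[OF assms(1) inj(1)]] by blast
qed

subsection \<open>Sequences of moves\<close>

abbreviation move :: "'a graph \<Rightarrow> 'a graph \<Rightarrow> bool" where
  "move A B \<equiv> triangle_Y A B \<or> Y_triangle A B"

lemma simple_move: "simple_graph G \<Longrightarrow> move G H \<Longrightarrow> simple_graph H"
  using triangle_Y_simple Y_triangle_simple by blast

lemma simple_moves: "move\<^sup>*\<^sup>* G H \<Longrightarrow> simple_graph G \<Longrightarrow> simple_graph H"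
  by (induction rule: rtranclp_induct) (auto dest: simple_move)

lemma move_iff_triangle_Y:
  assumes "simple_graph G" "simple_graph H"
  shows "move G H \<longleftrightarrow> triangle_Y G H \<or> triangle_Y H G"
  using Y_triangle_iff_triangle_Y[OF assms] by simp

lemma move_cases [consumes 2, case_names triangle_Y Y_triangle]:
  assumes "simple_graph G" "move G H"
  obtains "triangle_Y G H" | "triangle_Y H G"
  using assms move_iff_triangle_Y[OF assms(1) simple_move[OF assms]] by blast

lemma card_edges_move: "simple_graph G \<Longrightarrow> move G H \<Longrightarrow> card (edges H) = card (edges G)"
  using triangle_Y_invariants(1) simple_move by (metis move_cases)

lemma card_edges_moves:
  assumes "move\<^sup>*\<^sup>* G H" "simple_graph G"
  shows "card (edges H) = card (edges G)"
  using assms(1)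
proof induction
  case (step A B)
  then show ?case
    using card_edges_move[OF simple_moves[OF step.hyps(1) assms(2)] step.hyps(2)] by simp
qed simp

subsection \<open>Graphs with a marked vertex set\<close>

definition marked_graph :: "'a set \<Rightarrow> 'a graph \<Rightarrow> bool" where
  "marked_graph S G \<longleftrightarrow> simple_graph G \<and> S \<subseteq> verts G"

definition marked_iso :: "'a set \<Rightarrow> 'a graph \<Rightarrow> 'a graph \<Rightarrow> bool" where
  "marked_iso S G H \<longleftrightarrow>
     marked_graph S G \<and> (\<exists>h. inj_on h (verts G) \<and> h ` S = S \<and> H = map_graph h G)"

lemma marked_isoI:
  "marked_graph S G \<Longrightarrow> inj_on h (verts G) \<Longrightarrow> h ` S = S \<Longrightarrow> marked_iso S G (map_graph h G)"
  by (auto simp: marked_iso_def)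

lemma marked_isoE:
  assumes "marked_iso S G H"
  obtains h where "inj_on h (verts G)" "h ` S = S" "H = map_graph h G"
  using assms by (auto simp: marked_iso_def)

lemma marked_graph_map_graph:
  assumes "marked_graph S G" "inj_on h (verts G)" "h ` S = S"
  shows "marked_graph S (map_graph h G)"
  using assms simple_map_graph[of G h] image_mono[of S "verts G" h]
  by (auto simp: marked_graph_def)

lemma marked_iso_imp_marked_graph:
  assumes "marked_iso S G H"
  shows "marked_graph S G" "marked_graph S H"
  using assms marked_graph_map_graph[of S G] by (auto simp: marked_iso_def)

lemma graph_iso_iff_map_graph: "graph_iso G H \<longleftrightarrow> (\<exists>h. inj_on h (verts G) \<and> H = map_graph h G)"
  by (auto simp: graph_iso_def bij_betw_def prod_eq_iff)

lemma marked_iso_imp_graph_iso: "marked_iso S G H \<Longrightarrow> graph_iso G H"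
  by (auto simp: marked_iso_def graph_iso_iff_map_graph)

lemma card_verts_graph_iso: "graph_iso G H \<Longrightarrow> card (verts H) = card (verts G)"
  by (auto simp: graph_iso_iff_map_graph card_image)

lemma marked_iso_refl: "marked_graph S G \<Longrightarrow> marked_iso S G G"
  using marked_isoI[of S G id] by simp

lemma marked_iso_sym:
  assumes "marked_iso S G H"
  shows "marked_iso S H G"
proof -
  have marked_G: "simple_graph G" "S \<subseteq> verts G" and marked_H: "marked_graph S H"
    using marked_iso_imp_marked_graph[OF assms] by (simp_all add: marked_graph_def)
  obtain h where h: "inj_on h (verts G)" "h ` S = S" "H = map_graph h G"
    using assms by (rule marked_isoE)
  let ?g = "inv_into (verts G) h"
  have "inj_on ?g (verts H)" by (simp add: h(3) inj_on_inv_into)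
  moreover have "?g ` S = S" using inv_into_image_cancel[OF h(1) marked_G(2)] h(2) by simp
  moreover have "map_graph ?g H = G"
    unfolding h(3) using marked_G(1) h(1) by (rule map_graph_inv_into)
  ultimately show ?thesis using marked_isoI[OF marked_H] by metis
qed

lemma marked_iso_trans:
  assumes "marked_iso S G H" "marked_iso S H K"
  shows "marked_iso S G K"
proof -
  obtain h where h: "inj_on h (verts G)" "h ` S = S" "H = map_graph h G"
    using assms(1) by (rule marked_isoE)
  obtain g where g: "inj_on g (verts H)" "g ` S = S" "K = map_graph g H"
    using assms(2) by (rule marked_isoE)
  have "K = map_graph (g \<circ> h) G" by (simp add: g(3) h(3) map_graph_comp)
  moreover have "inj_on (g \<circ> h) (verts G)" using h g by (auto intro: comp_inj_on)
  moreover have "(g \<circ> h) ` S = S" using h(2) g(2) by (metis image_comp)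
  ultimately show ?thesis using marked_isoI marked_iso_imp_marked_graph(1)[OF assms(1)] by metis
qed

lemma move_marked_iso:
  fixes G H G' :: "'a::infinite graph"
  assumes iso: "marked_iso S G G'" and move: "move G H" and S_subset_H: "S \<subseteq> verts H"
  obtains H' where "move G' H'" "marked_iso S H H'"
proof -
  have simple: "simple_graph G" "simple_graph G'" and S_subset_G: "S \<subseteq> verts G"
    using marked_iso_imp_marked_graph[OF iso] by (simp_all add: marked_graph_def)
  have simple_H: "simple_graph H" using simple_move[OF simple(1) move] .
  obtain g where g: "inj_on g (verts G)" "g ` S = S" "G' = map_graph g G"
    using iso by (rule marked_isoE)
  from simple(1) move have "\<exists>h. inj_on h (verts H) \<and> h ` S = S \<and> move G' (map_graph h H)"
  proof (cases rule: move_cases)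
    case triangle_Y
    then obtain v where v: "v \<notin> verts G" "verts H = insert v (verts G)"
      by (auto simp: triangle_Y_def)
    obtain w where w: "w \<notin> verts G'" using fresh_vertex[OF simple(2,2)] .
    define h where "h = g(v := w)"
    have h_eq_g: "h x = g x" if "x \<in> verts G" for x using that v by (auto simp: h_def)
    have "inj_on h (verts H)"
      using g(1,3) v w by (auto simp: h_def inj_on_def)
    moreover have "h ` S = S" using g(2) S_subset_G h_eq_g by (metis image_cong subsetD)
    moreover have "map_graph h G = G'" unfolding g(3)
      using simple(1) h_eq_g by (rule map_graph_cong)
    ultimately show ?thesis using triangle_Y_map_graph[OF simple(1) triangle_Y] by metis
  next
    case Y_triangle
    then have "verts H \<subseteq> verts G" by (auto simp: triangle_Y_def)
    then have inj: "inj_on g (verts H)" by (rule inj_on_subset[OF g(1)])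
    have "triangle_Y (map_graph g H) G'"
      unfolding g(3) by (rule triangle_Y_map_graph[OF simple_H Y_triangle g(1)])
    then show ?thesis
      using inj g(2) move_iff_triangle_Y[OF simple(2) simple_map_graph[OF simple_H inj]] by blast
  qed
  then show ?thesis using that marked_isoI simple_H S_subset_H unfolding marked_graph_def by metis
qed

definition marked_cousin :: "'a set \<Rightarrow> 'a graph \<Rightarrow> 'a graph \<Rightarrow> bool" where
  "marked_cousin S K G \<longleftrightarrow> (\<exists>G'. move\<^sup>*\<^sup>* K G' \<and> marked_iso S G' G)"

lemma marked_cousin_refl: "marked_graph S K \<Longrightarrow> marked_cousin S K K"
  unfolding marked_cousin_def using marked_iso_refl by blast

lemma marked_cousin_imp_marked_graph: "marked_cousin S K G \<Longrightarrow> marked_graph S G"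
  unfolding marked_cousin_def using marked_iso_imp_marked_graph(2) by blast

lemma marked_cousin_marked_iso: "marked_cousin S K G \<Longrightarrow> marked_iso S G H \<Longrightarrow> marked_cousin S K H"
  unfolding marked_cousin_def using marked_iso_trans by blast

lemma marked_cousin_move:
  fixes K :: "'a::infinite graph"
  assumes "marked_cousin S K G" "move G H" "S \<subseteq> verts H"
  shows "marked_cousin S K H"
proof -
  obtain G' where G': "move\<^sup>*\<^sup>* K G'" "marked_iso S G' G"
    using assms(1) by (auto simp: marked_cousin_def)
  obtain H' where "move G' H'" "marked_iso S H H'"
    using move_marked_iso[OF marked_iso_sym[OF G'(2)] assms(2,3)] .
  then have "move\<^sup>*\<^sup>* K H'" "marked_iso S H' H"
    using rtranclp.rtrancl_into_rtrancl[of move, OF G'(1)] marked_iso_sym by blast+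
  then show ?thesis unfolding marked_cousin_def by blast
qed

subsection \<open>Bridges of a vertex set\<close>

definition closed_off :: "'a graph \<Rightarrow> 'a set \<Rightarrow> 'a set \<Rightarrow> bool" where
  "closed_off G S P \<longleftrightarrow> P \<subseteq> verts G - S \<and> (\<forall>p\<in>P. neighbours G p \<subseteq> P \<union> S)"

text \<open>The components of \<open>G - S\<close> are the minimal nonempty sets that no edge of \<open>G - S\<close> leaves; those
  adjacent to every vertex of \<open>S\<close> are its bridges.\<close>

definition bridges :: "'a graph \<Rightarrow> 'a set \<Rightarrow> 'a set set" where
  "bridges G S = {K. closed_off G S K \<and> K \<noteq> {} \<and>
     (\<forall>P. closed_off G S P \<longrightarrow> P \<subseteq> K \<longrightarrow> P = {} \<or> P = K) \<and> S \<subseteq> \<Union> (neighbours G ` K)}"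

lemma closed_off_neighbours: "closed_off G S P \<Longrightarrow> p \<in> P \<Longrightarrow> neighbours G p \<subseteq> P \<union> S"
  by (simp add: closed_off_def)

lemma bridges_closed_off: "K \<in> bridges G S \<Longrightarrow> closed_off G S K"
  and bridges_nonempty: "K \<in> bridges G S \<Longrightarrow> K \<noteq> {}"
  and bridges_attached: "K \<in> bridges G S \<Longrightarrow> S \<subseteq> \<Union> (neighbours G ` K)"
  by (simp_all add: bridges_def)

lemma bridges_minimal: "K \<in> bridges G S \<Longrightarrow> closed_off G S P \<Longrightarrow> P \<subseteq> K \<Longrightarrow> P = {} \<or> P = K"
  by (simp add: bridges_def)

lemma bridges_subset: "K \<in> bridges G S \<Longrightarrow> K \<subseteq> verts G - S"
  using bridges_closed_off[of K G S] by (simp add: closed_off_def)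

lemma bridges_disjoint:
  assumes "K \<in> bridges G S" "L \<in> bridges G S" "K \<noteq> L"
  shows "K \<inter> L = {}"
proof -
  have "closed_off G S (K \<inter> L)"
    using bridges_closed_off[OF assms(1)] bridges_closed_off[OF assms(2)]
    unfolding closed_off_def by blast
  then have "K \<inter> L = {} \<or> K \<inter> L = K" "K \<inter> L = {} \<or> K \<inter> L = L"
    using bridges_minimal[OF assms(1)] bridges_minimal[OF assms(2)] by simp_all
  then show ?thesis using assms(3) by argo
qed

lemma finite_bridges: "simple_graph G \<Longrightarrow> finite (bridges G S)"
  by (rule finite_subset[of _ "Pow (verts G)"]) (auto dest: bridges_subset simp: simple_graph_def)

lemma image_subset_image_iff:
  "inj_on h V \<Longrightarrow> A \<subseteq> V \<Longrightarrow> B \<subseteq> V \<Longrightarrow> h ` A \<subseteq> h ` B \<longleftrightarrow> A \<subseteq> B"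
  unfolding image_subset_iff using inj_on_image_mem_iff[of h V _ B] by blast

lemma closed_off_map_graph_iff:
  assumes simple_G: "simple_graph G"
    and inj_h: "inj_on h (verts G)" and "S \<subseteq> verts G" "P \<subseteq> verts G"
  shows "closed_off (map_graph h G) (h ` S) (h ` P) \<longleftrightarrow> closed_off G S P"
proof -
  note img = image_subset_image_iff[OF inj_h]
  have "h ` P \<subseteq> h ` verts G - h ` S \<longleftrightarrow> P \<subseteq> verts G - S"
    using img[of P "verts G - S"] inj_on_image_set_diff[OF inj_h, of "verts G" S] assms(3,4)
    by auto
  moreover have "neighbours (map_graph h G) (h p) \<subseteq> h ` P \<union> h ` S \<longleftrightarrow> neighbours G p \<subseteq> P \<union> S"
    if "p \<in> P" for p
  proof -
    have "neighbours G p \<subseteq> verts G" "P \<union> S \<subseteq> verts G" "p \<in> verts G"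
      using neighbours_subset_verts[OF simple_G, of p] that assms(3,4) by auto
    then show ?thesis using img neighbours_map_graph[OF simple_G inj_h] by (simp flip: image_Un)
  qed
  ultimately show ?thesis by (simp add: closed_off_def)
qed

lemma image_bridges_subset:
  assumes simple_G: "simple_graph G" and inj_h: "inj_on h (verts G)" and S_subset: "S \<subseteq> verts G"
  shows "(`) h ` bridges G S \<subseteq> bridges (map_graph h G) (h ` S)"
proof
  fix L assume "L \<in> (`) h ` bridges G S"
  then obtain K where K: "K \<in> bridges G S" "L = h ` K" by blast
  have K_subset: "K \<subseteq> verts G" using bridges_subset[OF K(1)] by blast
  note closed = closed_off_map_graph_iff[OF simple_G inj_h S_subset]
  have "P = {} \<or> P = L" if P: "closed_off (map_graph h G) (h ` S) P" "P \<subseteq> L" for P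
  proof -
    obtain Q where Q: "Q \<subseteq> K" "P = h ` Q" using P(2) K(2) by (auto elim: subset_imageE)
    then have "closed_off G S Q" using P(1) K_subset closed[of Q] by auto
    then show ?thesis using bridges_minimal[OF K(1) _ Q(1)] K(2) Q(2) by auto
  qed
  moreover have "h ` S \<subseteq> \<Union> (neighbours (map_graph h G) ` L)"
  proof -
    have "neighbours (map_graph h G) (h k) = h ` neighbours G k" if "k \<in> K" for k
      using that K_subset neighbours_map_graph[OF simple_G inj_h] by blast
    then have "\<Union> (neighbours (map_graph h G) ` L) = h ` \<Union> (neighbours G ` K)"
      by (simp add: K(2) image_UN)
    then show ?thesis using bridges_attached[OF K(1)] by (simp add: image_mono)
  qed
  ultimately show "L \<in> bridges (map_graph h G) (h ` S)"
    using closed[OF K_subset] bridges_closed_off[OF K(1)] bridges_nonempty[OF K(1)]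
    by (simp add: bridges_def K(2))
qed

lemma bridges_map_graph:
  assumes simple_G: "simple_graph G" and inj_h: "inj_on h (verts G)" and S_subset: "S \<subseteq> verts G"
  shows "bridges (map_graph h G) (h ` S) = (`) h ` bridges G S"
proof
  let ?g = "inv_into (verts G) h"
  show "bridges (map_graph h G) (h ` S) \<subseteq> (`) h ` bridges G S"
  proof
    fix L assume L_bridge: "L \<in> bridges (map_graph h G) (h ` S)"
    have "(`) ?g ` bridges (map_graph h G) (h ` S) \<subseteq>
        bridges (map_graph ?g (map_graph h G)) (?g ` h ` S)"
      using S_subset
      by (intro image_bridges_subset simple_map_graph simple_G inj_h) (auto intro: inj_on_inv_into)
    then have "?g ` L \<in> bridges G S"
      using L_bridge inj_h S_subset by (auto simp: map_graph_inv_into[OF simple_G inj_h])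
    moreover have "h ` ?g ` L = L"
      using bridges_subset[OF L_bridge] by (intro image_inv_into_cancel[OF refl]) auto
    ultimately show "L \<in> (`) h ` bridges G S" by (metis imageI)
  qed
qed (rule image_bridges_subset[OF assms])

definition frame :: "nat \<Rightarrow> nat \<Rightarrow> 'a graph \<Rightarrow> 'a set \<Rightarrow> bool" where
  "frame n c G S \<longleftrightarrow> marked_graph S G \<and> card S = n \<and> card (bridges G S) = c"

lemma frame_map_graph:
  assumes "frame n c G S" "inj_on h (verts G)"
  shows "frame n c (map_graph h G) (h ` S)"
proof -
  have simple_G: "simple_graph G" and frame_S: "S \<subseteq> verts G" "card S = n" "card (bridges G S) = c"
    using assms(1) by (auto simp: frame_def marked_graph_def)
  have "inj_on ((`) h) (bridges G S)"
    using bridges_subset by (intro inj_on_subset[OF inj_on_image_Pow[OF assms(2)]]) blast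
  moreover have "inj_on h S" using assms(2) frame_S(1) by (rule inj_on_subset)
  ultimately show ?thesis
    using simple_map_graph[OF simple_G assms(2)] frame_S
      bridges_map_graph[OF simple_G assms(2) frame_S(1)]
    by (auto simp: frame_def marked_graph_def card_image)
qed

lemma frame_degree:
  assumes "frame n c G S" and s_in: "s \<in> S"
  shows "c \<le> card (neighbours G s)"
proof -
  have simple_G: "simple_graph G" and card_bridges: "card (bridges G S) = c"
    using assms(1) by (auto simp: frame_def marked_graph_def)
  have "\<forall>K\<in>bridges G S. \<exists>k\<in>K. s \<in> neighbours G k" using s_in bridges_attached by blast
  then obtain k where k: "\<And>K. K \<in> bridges G S \<Longrightarrow> k K \<in> K \<and> s \<in> neighbours G (k K)" by metis
  have "inj_on k (bridges G S)"
    using k bridges_disjoint unfolding inj_on_def by (metis disjoint_iff)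
  moreover have "k ` bridges G S \<subseteq> neighbours G s" using k neighbours_commute by fast
  moreover have "finite (neighbours G s)"
    using simple_G neighbours_subset_verts[OF simple_G]
    by (auto simp: simple_graph_def intro: finite_subset)
  ultimately show ?thesis using card_bridges card_inj_on_le by metis
qed

subsection \<open>Invariance of the number of bridges\<close>

locale triangle_Y_step = triangle_packing G "{v}" "\<lambda>_. T"
  for G :: "'a graph" and v :: 'a and T :: "'a set" +
  fixes S :: "'a set"
  assumes S_subset: "S \<subseteq> verts G"
begin

abbreviation "H \<equiv> replace_triangle G v T"

lemma v_notin: "v \<notin> verts G" "v \<notin> S" "v \<notin> T" "v \<notin> neighbours G p"
  using new S_subset triangle_not_new[of v v] neighbours_subset_verts[OF simple, of p] by auto

lemma triangle_T: "triangle G T" "T \<subseteq> verts G"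
  using triangles triangle_subset by simp_all

lemma neighbours_v: "neighbours H v = T"
  by (rule neighbours_replaced_new) simp

lemma neighbours_old:
  assumes "p \<noteq> v"
  shows "neighbours H p = (if p \<in> T then insert v (neighbours G p - T) else neighbours G p)"
proof -
  have "v \<in> neighbours H p \<longleftrightarrow> p \<in> T" using neighbours_v neighbours_commute by metis
  moreover have "q \<in> neighbours H p \<longleftrightarrow> q \<in> neighbours G p \<and> \<not> {p, q} \<subseteq> T" if "q \<noteq> v" for q
    using edge_replaced_old_iff[of p q] assms that by (simp add: neighbours_def)
  ultimately have "q \<in> neighbours H p \<longleftrightarrow>
      q \<in> (if p \<in> T then insert v (neighbours G p - T) else neighbours G p)" for q
    using v_notin(4)[of p] by (cases "q = v") auto
  then show ?thesis by blast
qed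

lemma triangle_subset_neighbours: "p \<in> T \<Longrightarrow> T - {p} \<subseteq> neighbours G p"
  using triangle_edge[OF triangle_T(1)] by (auto simp: neighbours_def)

definition lift :: "'a set \<Rightarrow> 'a set" where
  "lift P = (if P \<inter> T = {} then P else insert v P)"

lemma lift_mono: "P \<subseteq> Q \<Longrightarrow> lift P \<subseteq> lift Q"
  by (auto simp: lift_def)

lemma remove_lift: "closed_off G S P \<Longrightarrow> lift P - {v} = P"
  using v_notin(1) by (auto simp: lift_def closed_off_def)

lemma closed_off_triangle: "closed_off G S P \<Longrightarrow> P \<inter> T \<noteq> {} \<Longrightarrow> T \<subseteq> P \<union> S"
  using closed_off_neighbours[of G S P] triangle_subset_neighbours by blast

lemma closed_off_new: "closed_off H S P \<Longrightarrow> P \<inter> T \<noteq> {} \<Longrightarrow> v \<in> P"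
  using closed_off_neighbours[of H S P] neighbours_commute[of v H] neighbours_v v_notin(2) by blast

lemma lift_remove_subset: "closed_off H S P \<Longrightarrow> lift (P - {v}) \<subseteq> P"
  using closed_off_new[of P] by (auto simp: lift_def)

lemma closed_off_remove:
  assumes closed_P: "closed_off H S P"
  shows "closed_off G S (P - {v})"
proof -
  have "neighbours G p \<subseteq> P - {v} \<union> S" if p_in: "p \<in> P" "p \<noteq> v" for p
  proof (cases "p \<in> T")
    case True
    then have "v \<in> P" using closed_off_new[OF closed_P] p_in by blast
    then have "T \<subseteq> P \<union> S" using closed_off_neighbours[OF closed_P] neighbours_v by blast
    moreover have "neighbours G p - T \<subseteq> P \<union> S"
      using closed_off_neighbours[OF closed_P p_in(1)] neighbours_old[OF p_in(2)] True by auto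
    ultimately show ?thesis using v_notin(4)[of p] by blast
  next
    case False
    then show ?thesis
      using closed_off_neighbours[OF closed_P p_in(1)] neighbours_old[OF p_in(2)] v_notin(4)[of p]
      by auto
  qed
  then show ?thesis using closed_P by (auto simp: closed_off_def)
qed

lemma closed_off_lift:
  assumes closed_P: "closed_off G S P"
  shows "closed_off H S (lift P)"
proof -
  have "neighbours H p \<subseteq> lift P \<union> S" if p_in: "p \<in> lift P" for p
  proof (cases "p = v")
    case True
    then have "P \<inter> T \<noteq> {}"
      using p_in closed_P v_notin(1) by (auto simp: lift_def closed_off_def split: if_splits)
    then show ?thesis
      using True closed_off_triangle[OF closed_P] neighbours_v by (auto simp: lift_def)
  next
    case False
    then have p_in_P: "p \<in> P" using p_in by (auto simp: lift_def split: if_splits)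
    have "neighbours H p \<subseteq> (if p \<in> T then insert v (neighbours G p) else neighbours G p)"
      using neighbours_old[OF False] by auto
    then show ?thesis
      using closed_off_neighbours[OF closed_P p_in_P] p_in_P
      by (auto simp: lift_def split: if_splits)
  qed
  then show ?thesis using closed_P v_notin(2) by (auto simp: closed_off_def lift_def)
qed

lemma attachments_lift:
  assumes closed_P: "closed_off G S P"
  shows "S \<inter> \<Union> (neighbours H ` lift P) = S \<inter> \<Union> (neighbours G ` P)"
proof -
  have v_notin_P: "v \<notin> P" and P_disjoint_S: "P \<inter> S = {}"
    using closed_P v_notin(1) by (auto simp: closed_off_def)
  have neighbours_P: "neighbours H p =
      (if p \<in> T then insert v (neighbours G p - T) else neighbours G p)"
    if "p \<in> P" for p using neighbours_old that v_notin_P by metis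
  show ?thesis
  proof (cases "P \<inter> T = {}")
    case True
    then have "neighbours H p = neighbours G p" if "p \<in> P" for p using neighbours_P that by auto
    then show ?thesis using True by (simp add: lift_def)
  next
    case False
    then obtain q where q: "q \<in> P" "q \<in> T" by blast
    then have triangle_covered: "S \<inter> T \<subseteq> neighbours G q"
      using triangle_subset_neighbours P_disjoint_S by blast
    have "S \<inter> \<Union> (neighbours H ` lift P) = S \<inter> (T \<union> \<Union> (neighbours H ` P))"
      using False by (simp add: lift_def neighbours_v)
    also have "\<dots> = S \<inter> (T \<union> \<Union> (neighbours G ` P))"
      using neighbours_P v_notin(2) by (auto split: if_splits)
    also have "\<dots> = S \<inter> \<Union> (neighbours G ` P)" using triangle_covered q(1) by blast
    finally show ?thesis .
  qed
qed

lemma bridge_meets_triangle: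
  assumes bridge_K: "K \<in> bridges H S" "v \<in> K" and "card S \<noteq> 3"
  shows "K \<inter> T \<noteq> {}"
proof
  assume "K \<inter> T = {}"
  then have T_subset_S: "T \<subseteq> S"
    using closed_off_neighbours[OF bridges_closed_off[OF bridge_K(1)] bridge_K(2)] neighbours_v
    by blast
  then have "closed_off H S {v}" using neighbours_v v_notin(2) by (auto simp: closed_off_def)
  then have "K = {v}" using bridges_minimal[OF bridge_K(1)] bridge_K(2) by blast
  then have "S \<subseteq> T" using bridges_attached[OF bridge_K(1)] neighbours_v by simp
  then show False using T_subset_S triangle_T(1) assms(3) by (auto simp: triangle_def)
qed

lemma lift_remove:
  assumes "K \<in> bridges H S" "card S \<noteq> 3"
  shows "lift (K - {v}) = K"
  using bridge_meets_triangle[OF assms(1) _ assms(2)]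
    closed_off_new[OF bridges_closed_off[OF assms(1)]]
    v_notin(3) by (auto simp: lift_def)

lemma bridges_remove:
  assumes bridge_K: "K \<in> bridges H S" and size_S: "card S \<noteq> 3"
  shows "K - {v} \<in> bridges G S"
proof -
  have closed: "closed_off G S (K - {v})"
    by (rule closed_off_remove[OF bridges_closed_off[OF bridge_K]])
  have "P = {} \<or> P = K - {v}" if P: "closed_off G S P" "P \<subseteq> K - {v}" for P
  proof -
    have "lift P \<subseteq> K" using lift_mono[OF P(2)] lift_remove[OF bridge_K size_S] by simp
    then have "lift P = {} \<or> lift P = K"
      by (rule bridges_minimal[OF bridge_K closed_off_lift[OF P(1)]])
    then show ?thesis using remove_lift[OF P(1)] by auto
  qed
  moreover have "K - {v} \<noteq> {}"
    using bridges_nonempty[OF bridge_K] lift_remove[OF bridge_K size_S]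
    by (metis lift_def inf_bot_left)
  moreover have "S \<subseteq> \<Union> (neighbours G ` (K - {v}))"
    using attachments_lift[OF closed] bridges_attached[OF bridge_K] lift_remove[OF bridge_K size_S]
    by auto
  ultimately show ?thesis using closed by (simp add: bridges_def)
qed

lemma bridges_lift:
  assumes bridge_K: "K \<in> bridges G S"
  shows "lift K \<in> bridges H S"
proof -
  note closed = bridges_closed_off[OF bridge_K]
  have "P = {} \<or> P = lift K" if P: "closed_off H S P" "P \<subseteq> lift K" for P
  proof -
    have "P - {v} \<subseteq> K" using P(2) remove_lift[OF closed] by blast
    then consider (trivial) "P - {v} = {}" | (full) "P - {v} = K"
      using bridges_minimal[OF bridge_K closed_off_remove[OF P(1)]] by blast
    then show ?thesis
    proof cases
      case trivial
      have "v \<notin> P"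
      proof
        assume v_in_P: "v \<in> P"
        then have "T \<subseteq> S"
          using closed_off_neighbours[OF P(1)] neighbours_v trivial v_notin(3) by blast
        then have "lift K = K" using bridges_subset[OF bridge_K] by (auto simp: lift_def)
        then show False using v_in_P P(2) bridges_subset[OF bridge_K] v_notin(1) by blast
      qed
      then show ?thesis using trivial by auto
    next
      case full
      then show ?thesis using lift_remove_subset[OF P(1)] P(2) by auto
    qed
  qed
  moreover have "lift K \<noteq> {}" using bridges_nonempty[OF bridge_K] by (simp add: lift_def)
  moreover have "S \<subseteq> \<Union> (neighbours H ` lift K)"
    using attachments_lift[OF closed] bridges_attached[OF bridge_K] by auto
  ultimately show ?thesis using closed_off_lift[OF closed] by (simp add: bridges_def)
qed

lemma card_bridges_replace_triangle:
  assumes "card S \<noteq> 3"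
  shows "card (bridges H S) = card (bridges G S)"
proof (rule bij_betw_same_card)
  show "bij_betw (\<lambda>K. K - {v}) (bridges H S) (bridges G S)"
    using lift_remove[OF _ assms] bridges_remove[OF _ assms] bridges_lift
      remove_lift[OF bridges_closed_off]
    by (intro bij_betw_byWitness[where f' = lift]) auto
qed

lemma frame_replace_triangle_iff: "n \<noteq> 3 \<Longrightarrow> frame n c H S \<longleftrightarrow> frame n c G S"
  using card_bridges_replace_triangle simple simple_replaced S_subset
  by (auto simp: frame_def marked_graph_def)

end

text \<open>A vertex of \<open>S\<close> has degree at least \<open>c \<ge> 4\<close>, so a Y-Triangle move cannot remove it.\<close>

lemma frame_triangle_Y_iff:
  assumes "simple_graph G" "triangle_Y G H" "n \<noteq> 3" "4 \<le> c"
  shows "frame n c H S \<longleftrightarrow> frame n c G S"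
proof -
  obtain v T where packing: "triangle_packing G {v} (\<lambda>_. T)" and H_eq: "H = replace_triangle G v T"
    using assms(2) triangle_Y_iff[OF assms(1)] by blast
  have "S \<subseteq> verts G" if frame_H: "frame n c H S"
  proof -
    have "card (neighbours H v) = 3"
      using triangle_packing.neighbours_replaced_new[OF packing]
        triangle_packing.triangles[OF packing]
      by (simp add: H_eq triangle_def)
    then have "v \<notin> S" using frame_degree[OF frame_H, of v] assms(4) by auto
    then show ?thesis using frame_H by (auto simp: frame_def marked_graph_def H_eq)
  qed
  moreover have "frame n c H S \<longleftrightarrow> frame n c G S" if "S \<subseteq> verts G"
  proof -
    have "triangle_Y_step G v T S"
      using packing that by (simp add: triangle_Y_step_def triangle_Y_step_axioms_def)
    then show ?thesis
      unfolding H_eq by (rule triangle_Y_step.frame_replace_triangle_iff[OF _ assms(3)])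
  qed
  ultimately show ?thesis by (auto simp: frame_def marked_graph_def)
qed

lemma frame_moves:
  assumes "move\<^sup>*\<^sup>* G H" "simple_graph G" "n \<noteq> 3" "4 \<le> c"
  shows "frame n c H = frame n c G"
  using assms(1)
proof induction
  case (step A B)
  have simple_A: "simple_graph A" using simple_moves[OF step.hyps(1) assms(2)] .
  from simple_A step.hyps(2) have "frame n c B S \<longleftrightarrow> frame n c A S" for S
  proof (cases rule: move_cases)
    case triangle_Y
    then show ?thesis by (rule frame_triangle_Y_iff[OF simple_A _ assms(3,4)])
  next
    case Y_triangle
    then show ?thesis
      using frame_triangle_Y_iff[OF simple_move[OF simple_A step.hyps(2)] _ assms(3,4)] by blast
  qed
  then show ?case using step.IH by auto
qed simp

subsection \<open>Full vertices\<close>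

definition full_vertex :: "'a graph \<Rightarrow> 'a set \<Rightarrow> 'a \<Rightarrow> bool" where
  "full_vertex G S f \<longleftrightarrow> f \<in> verts G - S \<and> neighbours G f = S"

lemma full_vertex_if_singleton_bridge:
  assumes "simple_graph G" "{f} \<in> bridges G S"
  shows "full_vertex G S f"
  using neighbours_subset_verts[OF assms(1), of f] bridges_subset[OF assms(2)]
    bridges_attached[OF assms(2)] closed_off_neighbours[OF bridges_closed_off[OF assms(2)]]
  by (auto simp: full_vertex_def)

definition edges_meeting :: "'a graph \<Rightarrow> 'a set \<Rightarrow> 'a set set" where
  "edges_meeting G K = {e \<in> edges G. e \<inter> K \<noteq> {}}"

lemma finite_edges_meeting: "simple_graph G \<Longrightarrow> finite (edges_meeting G K)"
  using finite_edges[of G] by (simp add: edges_meeting_def)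

text \<open>One edge to each vertex of \<open>S\<close>, and one inside the bridge.\<close>

lemma card_edges_meeting_bridge:
  assumes simple_G: "simple_graph G" and bridge_K: "K \<in> bridges G S" "\<nexists>f. K = {f}" and "finite S"
  shows "card S + 1 \<le> card (edges_meeting G K)"
proof -
  have K_disjoint_S: "K \<inter> S = {}" using bridges_subset[OF bridge_K(1)] by blast
  obtain f where f: "f \<in> K" using bridges_nonempty[OF bridge_K(1)] by auto
  have "\<not> closed_off G S {f}" using bridges_minimal[OF bridge_K(1), of "{f}"] f bridge_K(2) by auto
  then obtain g where g: "{f, g} \<in> edges G" "g \<notin> S"
    using f bridges_subset[OF bridge_K(1)] by (auto simp: closed_off_def neighbours_def)
  have "\<forall>s\<in>S. \<exists>k\<in>K. {k, s} \<in> edges G"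
    using bridges_attached[OF bridge_K(1)] by (auto simp: neighbours_def)
  then obtain k where k: "\<And>s. s \<in> S \<Longrightarrow> k s \<in> K \<and> {k s, s} \<in> edges G" by metis
  define E where "E = (\<lambda>s. {k s, s}) ` S"
  have "inj_on (\<lambda>s. {k s, s}) S"
    using k K_disjoint_S by (intro inj_onI) (auto simp: doubleton_eq_iff)
  moreover have "{f, g} \<notin> E" using f g(2) K_disjoint_S by (auto simp: E_def doubleton_eq_iff)
  ultimately have "card S + 1 = card (insert {f, g} E)"
    using assms(4) by (simp add: E_def card_image)
  also have "\<dots> \<le> card (edges_meeting G K)"
    using f g(1) k finite_edges_meeting[OF simple_G]
    by (intro card_mono) (auto simp: E_def edges_meeting_def)
  finally show ?thesis .
qed

lemma edges_meeting_bridges_disjoint: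
  assumes simple_G: "simple_graph G"
    and bridge_K: "K \<in> bridges G S" and bridge_L: "L \<in> bridges G S" "K \<noteq> L"
  shows "edges_meeting G K \<inter> edges_meeting G L = {}"
proof (rule ccontr)
  assume "edges_meeting G K \<inter> edges_meeting G L \<noteq> {}"
  then obtain e where e: "e \<in> edges G" "e \<inter> K \<noteq> {}" "e \<inter> L \<noteq> {}" by (auto simp: edges_meeting_def)
  then obtain p q where pq: "p \<in> K" "q \<in> L" "{p, q} \<subseteq> e" by blast
  moreover have K_disjoint_L: "K \<inter> L = {}" using bridges_disjoint[OF bridge_K bridge_L] .
  ultimately have "p \<noteq> q" by blast
  moreover have "card e = 2" using simple_G e(1) by (simp add: simple_graph_def)
  ultimately have "e = {p, q}"
    using pq(3) card_subset_eq[of e "{p, q}"] by (simp add: card_ge_0_finite)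
  then have "q \<in> K \<union> S"
    using closed_off_neighbours[OF bridges_closed_off[OF bridge_K] pq(1)] e(1)
    by (auto simp: neighbours_def)
  then show False using K_disjoint_L pq(2) bridges_subset[OF bridge_L(1)] by blast
qed

lemma frame_imp_full_vertex:
  assumes frame_G: "frame n c G S" and "card (edges G) < c * (n + 1)"
  shows "\<exists>f. full_vertex G S f"
proof (rule ccontr)
  assume no_full: "\<nexists>f. full_vertex G S f"
  have simple_G: "simple_graph G"
    and frame_S: "S \<subseteq> verts G" "card S = n" and card_bridges: "card (bridges G S) = c"
    using frame_G by (auto simp: frame_def marked_graph_def)
  have "finite S" using simple_G frame_S by (auto simp: simple_graph_def intro: finite_subset)
  then have "n + 1 \<le> card (edges_meeting G K)" if "K \<in> bridges G S" for K
    using card_edges_meeting_bridge[OF simple_G that]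
      full_vertex_if_singleton_bridge[OF simple_G] no_full that frame_S(2)
    by metis
  then have "c * (n + 1) \<le> (\<Sum>K\<in>bridges G S. card (edges_meeting G K))"
    using sum_bounded_below[of "bridges G S" "n + 1" "\<lambda>K. card (edges_meeting G K)"] card_bridges
    by simp
  also have "\<dots> = card (\<Union>K\<in>bridges G S. edges_meeting G K)"
    using edges_meeting_bridges_disjoint[OF simple_G] finite_edges_meeting[OF simple_G]
      finite_bridges[OF simple_G]
    by (subst card_UN_disjoint) auto
  also have "\<dots> \<le> card (edges G)"
    using finite_edges[OF simple_G] by (intro card_mono) (auto simp: edges_meeting_def)
  finally show False using assms(2) by simp
qed

subsection \<open>Adding and deleting a full vertex\<close>

definition add_star :: "'a \<Rightarrow> 'a set \<Rightarrow> 'a graph \<Rightarrow> 'a graph" where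
  "add_star f S G = (insert f (verts G), edges G \<union> star f S)"

definition delete_vertex :: "'a \<Rightarrow> 'a graph \<Rightarrow> 'a graph" where
  "delete_vertex f G = (verts G - {f}, {e \<in> edges G. f \<notin> e})"

lemma verts_add_star [simp]: "verts (add_star f S G) = insert f (verts G)"
  and edges_add_star [simp]: "edges (add_star f S G) = edges G \<union> star f S"
  by (simp_all add: add_star_def)

lemma simple_add_star:
  "simple_graph G \<Longrightarrow> S \<subseteq> verts G \<Longrightarrow> f \<notin> verts G \<Longrightarrow> simple_graph (add_star f S G)"
  by (auto simp: simple_graph_def star_def card_insert_if)

lemma marked_graph_add_star: "marked_graph S G \<Longrightarrow> f \<notin> verts G \<Longrightarrow> marked_graph S (add_star f S G)"
  using simple_add_star[of G S f] by (auto simp: marked_graph_def)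

lemma simple_delete_vertex: "simple_graph G \<Longrightarrow> simple_graph (delete_vertex f G)"
  by (auto simp: simple_graph_def delete_vertex_def)

lemma delete_add_star:
  assumes "simple_graph G" "f \<notin> verts G"
  shows "delete_vertex f (add_star f S G) = G"
proof -
  have "f \<notin> e" if "e \<in> edges G" for e using that assms by (auto simp: simple_graph_def)
  then have "{e \<in> edges G \<union> star f S. f \<notin> e} = edges G" by (auto simp: star_def)
  then show ?thesis using assms(2) by (simp add: delete_vertex_def prod_eq_iff)
qed

lemma add_star_delete:
  assumes "simple_graph G" "full_vertex G S f"
  shows "add_star f S (delete_vertex f G) = G"
proof (rule graph_eqI)
  have f_in: "f \<in> verts G" "f \<notin> S" and neighbours_f: "neighbours G f = S"
    using assms(2) by (auto simp: full_vertex_def)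
  have S_subset: "S \<subseteq> verts G"
    using neighbours_subset_verts[OF assms(1), of f] neighbours_f by blast
  show "simple_graph (add_star f S (delete_vertex f G))"
    using S_subset f_in
    by (intro simple_add_star simple_delete_vertex assms(1)) (auto simp: delete_vertex_def)
  show "verts (add_star f S (delete_vertex f G)) = verts G"
    using f_in by (auto simp: delete_vertex_def)
  have "{f, q} \<in> edges G \<longleftrightarrow> q \<in> S" "{q, f} \<in> edges G \<longleftrightarrow> q \<in> S" for q
    using neighbours_f by (auto simp: neighbours_def insert_commute)
  then show "{p, q} \<in> edges (add_star f S (delete_vertex f G)) \<longleftrightarrow> {p, q} \<in> edges G" for p q
    using f_in(2) by (auto simp: delete_vertex_def doubleton_in_star_iff)
qed (rule assms(1))

lemma full_vertex_add_star:
  assumes "marked_graph S G" "f \<notin> verts G"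
  shows "full_vertex (add_star f S G) S f"
proof -
  have "{f, u} \<notin> edges G" for u
    using simple_graphD(2) assms by (fastforce simp: marked_graph_def)
  then have "neighbours (add_star f S G) f = S"
    using assms by (auto simp: neighbours_def doubleton_in_star_iff marked_graph_def)
  then show ?thesis using assms by (auto simp: full_vertex_def marked_graph_def)
qed

lemma map_graph_add_star: "map_graph h (add_star f S G) = add_star (h f) (h ` S) (map_graph h G)"
  by (simp add: map_graph_def add_star_def image_Un image_star)

lemma add_star_commute: "add_star f S (add_star g S G) = add_star g S (add_star f S G)"
  by (auto simp: add_star_def)

lemma map_graph_transpose_full_vertices:
  assumes simple_G: "simple_graph G"
    and full_f: "full_vertex G S f" and full_g: "full_vertex G S g"
  shows "map_graph (transpose f g) G = G"
proof (cases "f = g")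
  case True
  then show ?thesis by simp
next
  case False
  let ?t = "transpose f g" and ?X = "delete_vertex f (delete_vertex g G)"
  have "f \<notin> S" "g \<notin> S" using full_f full_g by (auto simp: full_vertex_def)
  then have image_S: "?t ` S = S" by simp
  have "map_graph ?t ?X = map_graph id ?X"
    using simple_G by (intro map_graph_cong simple_delete_vertex) (auto simp: delete_vertex_def)
  have "full_vertex (delete_vertex g G) S f"
    using full_f \<open>g \<notin> S\<close> False by (auto simp: full_vertex_def neighbours_def delete_vertex_def)
  then have "add_star f S ?X = delete_vertex g G"
    using add_star_delete[OF simple_delete_vertex[OF simple_G]] by blast
  then have G_eq: "add_star g S (add_star f S ?X) = G"
    using add_star_delete[OF simple_G full_g] by simp
  have "map_graph ?t (add_star g S (add_star f S ?X)) =
      add_star f S (add_star g S (map_graph ?t ?X))"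
    by (simp add: map_graph_add_star image_S)
  also have "\<dots> = add_star g S (add_star f S ?X)"
    using \<open>map_graph ?t ?X = map_graph id ?X\<close> by (simp add: add_star_commute[of f])
  finally show ?thesis unfolding G_eq .
qed

text \<open>Full vertices are twins, so an isomorphism may be assumed to match the added ones.\<close>

lemma marked_iso_add_star_cancel:
  assumes marked_G: "marked_graph S G" "f \<notin> verts G" and marked_H: "marked_graph S H" "g \<notin> verts H"
    and "marked_iso S (add_star f S G) (add_star g S H)"
  shows "marked_iso S G H"
proof -
  obtain h where h: "inj_on h (insert f (verts G))" "h ` S = S"
      "add_star g S H = map_graph h (add_star f S G)"
    using assms(5) by (auto elim: marked_isoE)
  have inj_h: "inj_on h (verts G)" and hf_new: "h f \<notin> verts (map_graph h G)"
    using h(1) marked_G(2) by simp_all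
  have marked_hG: "marked_graph S (map_graph h G)"
    using marked_G(1) inj_h h(2) by (rule marked_graph_map_graph)
  have "full_vertex (add_star g S H) S (h f)"
    unfolding h(3) map_graph_add_star h(2) using marked_hG hf_new by (rule full_vertex_add_star)
  moreover have "simple_graph (add_star g S H)"
    using marked_graph_add_star[OF marked_H] by (simp add: marked_graph_def)
  ultimately have transpose_fixes: "map_graph (transpose (h f) g) (add_star g S H) = add_star g S H"
    using map_graph_transpose_full_vertices full_vertex_add_star[OF marked_H] by metis
  define k where "k = transpose (h f) g \<circ> h"
  have k_f: "k f = g" by (simp add: k_def)
  have "inj_on k (insert f (verts G))"
    unfolding k_def by (rule comp_inj_on[OF h(1) inj_on_transpose])
  then have inj_k: "inj_on k (verts G)" "g \<notin> verts (map_graph k G)"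
    using marked_G(2) k_f by simp_all
  have "h f \<notin> S" "g \<notin> S" using marked_hG hf_new marked_H by (auto simp: marked_graph_def)
  then have k_image_S: "k ` S = S"
    using h(2) unfolding k_def by (metis image_comp transpose_image_eq)
  have "add_star g S (map_graph k G) = map_graph k (add_star f S G)"
    using k_f k_image_S by (simp add: map_graph_add_star)
  also have "\<dots> = add_star g S H" using transpose_fixes by (simp add: h(3) map_graph_comp k_def)
  finally have "map_graph k G = H"
    using delete_add_star simple_map_graph[OF _ inj_k(1)] inj_k(2) marked_G(1) marked_H
    unfolding marked_graph_def by metis
  then show ?thesis using marked_isoI[OF marked_G(1) inj_k(1) k_image_S] by simp
qed

lemma marked_iso_add_star:
  assumes "marked_iso S G H" and f_new: "f \<notin> verts G" and g_new: "g \<notin> verts H"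
  shows "marked_iso S (add_star f S G) (add_star g S H)"
proof -
  have marked_G: "marked_graph S G" using marked_iso_imp_marked_graph(1)[OF assms(1)] .
  obtain h where h: "inj_on h (verts G)" "h ` S = S" "H = map_graph h G"
    using assms(1) by (rule marked_isoE)
  let ?k = "h(f := g)"
  have k_eq_h: "?k x = h x" if "x \<in> verts G" for x using that f_new by auto
  have "map_graph ?k G = H"
    unfolding h(3) using marked_G k_eq_h by (intro map_graph_cong) (simp_all add: marked_graph_def)
  moreover have k_image_S: "?k ` S = S"
    using h(2) marked_G k_eq_h unfolding marked_graph_def by (metis image_cong subsetD)
  ultimately have "add_star g S H = map_graph ?k (add_star f S G)"
    by (simp add: map_graph_add_star)
  moreover have "inj_on ?k (verts (add_star f S G))"
    using h(1) g_new f_new by (auto simp: h(3) inj_on_def)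
  ultimately show ?thesis
    using marked_isoI[OF marked_graph_add_star[OF marked_G f_new] _ k_image_S] by metis
qed

lemma add_star_replace_triangles:
  assumes "\<And>y. y \<in> Y \<Longrightarrow> f \<notin> \<tau> y"
  shows "add_star f S (replace_triangles G Y \<tau>) = replace_triangles (add_star f S G) Y \<tau>"
proof -
  have "star f S \<inter> [\<tau> y]\<^bsup>2\<^esup> = {}" if "y \<in> Y" for y using assms[OF that] by (auto simp: star_def)
  then show ?thesis by (auto simp: add_star_def replace_triangles_def)
qed

lemma triangle_Y_add_star:
  assumes marked_G: "marked_graph S G" and "triangle_Y G H" and f_new: "f \<notin> verts H"
  shows "triangle_Y (add_star f S G) (add_star f S H)"
proof -
  have simple_G: "simple_graph G" using marked_G by (simp add: marked_graph_def)
  obtain v T where packing: "triangle_packing G {v} (\<lambda>_. T)" and H_eq: "H = replace_triangle G v T"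
    using assms(2) triangle_Y_iff[OF simple_G] by blast
  have f_fresh: "f \<notin> verts G" "f \<notin> T" "f \<noteq> v"
    using f_new triangle_packing.triangle_subset[OF packing] by (auto simp: H_eq)
  have simple_extended: "simple_graph (add_star f S G)"
    using marked_graph_add_star[OF marked_G f_fresh(1)] by (simp add: marked_graph_def)
  have "triangle_packing (add_star f S G) {v} (\<lambda>_. T)"
    using packing f_fresh simple_extended by (auto simp: triangle_packing_singleton triangle_def)
  moreover have "add_star f S H = replace_triangle (add_star f S G) v T"
    using f_fresh(2) by (simp add: H_eq add_star_replace_triangles)
  ultimately show ?thesis using triangle_Y_iff[OF simple_extended] by blast
qed

lemma move_add_star:
  assumes marked_G: "marked_graph S G" "f \<notin> verts G" and marked_H: "marked_graph S H" "f \<notin> verts H"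
    and move: "move G H"
  shows "move (add_star f S G) (add_star f S H)"
proof -
  have simple: "simple_graph G" "simple_graph H"
      "simple_graph (add_star f S G)" "simple_graph (add_star f S H)"
    using marked_G marked_H marked_graph_add_star[OF marked_G] marked_graph_add_star[OF marked_H]
    by (simp_all add: marked_graph_def)
  have "triangle_Y G H \<or> triangle_Y H G" using move move_iff_triangle_Y[OF simple(1,2)] by simp
  then have "triangle_Y (add_star f S G) (add_star f S H) \<or>
      triangle_Y (add_star f S H) (add_star f S G)"
    using triangle_Y_add_star[OF marked_G(1) _ marked_H(2)]
      triangle_Y_add_star[OF marked_H(1) _ marked_G(2)] by blast
  then show ?thesis using move_iff_triangle_Y[OF simple(3,4)] by simp
qed

lemma triangle_Y_full_vertexE:
  assumes marked_G: "marked_graph S G" "card S \<noteq> 3"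
    and triangle_Y: "triangle_Y G H" and full_f: "full_vertex H S f"
  obtains G' H' where "triangle_Y G' H'" "marked_graph S G'" "marked_graph S H'"
    "f \<notin> verts G'" "f \<notin> verts H'" "G = add_star f S G'" "H = add_star f S H'"
proof -
  have "simple_graph G" "S \<subseteq> verts G" using marked_G(1) by (simp_all add: marked_graph_def)
  moreover from this obtain v T
    where "triangle_packing G {v} (\<lambda>_. T)" and H_eq: "H = replace_triangle G v T"
    using triangle_Y triangle_Y_iff by blast
  ultimately interpret triangle_Y_step G v T S
    by (simp add: triangle_Y_step_def triangle_Y_step_axioms_def)
  have f_in_H: "f \<in> verts H" "f \<notin> S" and neighbours_f: "neighbours H f = S"
    using full_f by (auto simp: full_vertex_def)
  have f_neq_v: "f \<noteq> v"
    using neighbours_f neighbours_v triangle_T(1) marked_G(2) by (auto simp: H_eq triangle_def)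
  have f_notin_T: "f \<notin> T"
    using neighbours_f neighbours_old[OF f_neq_v] v_notin(2) by (auto simp: H_eq)
  let ?G = "delete_vertex f G" and ?H = "replace_triangle (delete_vertex f G) v T"
  have "neighbours G f = S"
    using neighbours_f neighbours_old[OF f_neq_v] f_notin_T by (simp add: H_eq)
  then have "full_vertex G S f" using f_in_H f_neq_v by (simp add: full_vertex_def H_eq)
  then have G_eq: "add_star f S ?G = G" by (rule add_star_delete[OF simple])
  have simple_deleted: "simple_graph ?G" using simple_delete_vertex[OF simple] .
  have "triangle_packing ?G {v} (\<lambda>_. T)"
    using triangle_T(1) v_notin(1) simple_deleted f_notin_T
    by (auto simp: triangle_packing_singleton triangle_def delete_vertex_def nsets_def)
  then have "triangle_Y ?G ?H" using triangle_Y_iff[OF simple_deleted] by blast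
  moreover from this have "simple_graph ?H" by (rule triangle_Y_simple[OF simple_deleted])
  moreover have "add_star f S ?H = H"
    using f_notin_T by (simp add: add_star_replace_triangles G_eq H_eq)
  ultimately show ?thesis
    using that[of ?G ?H] G_eq simple_deleted S_subset f_in_H(2) f_neq_v
    by (auto simp: marked_graph_def delete_vertex_def)
qed

lemma move_full_vertexE:
  assumes move: "move G H" and frames: "frame n c G S" "frame n c H S" and size: "n \<noteq> 3"
    and few_edges: "card (edges G) < c * (n + 1)"
  obtains f G' H' where "move G' H'" "marked_graph S G'" "marked_graph S H'"
    "f \<notin> verts G'" "f \<notin> verts H'" "G = add_star f S G'" "H = add_star f S H'"
proof -
  have marked: "marked_graph S G" "marked_graph S H" and card_S: "card S \<noteq> 3"
    using frames size by (simp_all add: frame_def)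
  have simple_G: "simple_graph G" using marked(1) by (simp add: marked_graph_def)
  have few_edges_H: "card (edges H) < c * (n + 1)"
    using few_edges card_edges_move[OF simple_G move] by simp
  from simple_G move show ?thesis
  proof (cases rule: move_cases)
    case triangle_Y
    obtain f where "full_vertex H S f"
      using frame_imp_full_vertex[OF frames(2) few_edges_H] by blast
    then obtain G' H' where decomposition: "triangle_Y G' H'"
        "marked_graph S G'" "marked_graph S H'"
        "f \<notin> verts G'" "f \<notin> verts H'" "G = add_star f S G'" "H = add_star f S H'"
      by (rule triangle_Y_full_vertexE[OF marked(1) card_S triangle_Y])
    show ?thesis by (rule that[OF disjI1[OF decomposition(1)] decomposition(2-7)])
  next
    case Y_triangle
    obtain f where "full_vertex G S f" using frame_imp_full_vertex[OF frames(1) few_edges] by blast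
    then obtain H' G' where decomposition: "triangle_Y H' G'"
        "marked_graph S H'" "marked_graph S G'"
        "f \<notin> verts H'" "f \<notin> verts G'" "H = add_star f S H'" "G = add_star f S G'"
      by (rule triangle_Y_full_vertexE[OF marked(2) card_S Y_triangle])
    have "simple_graph G'" "simple_graph H'"
      using decomposition(2,3) by (simp_all add: marked_graph_def)
    then have "move G' H'" using move_iff_triangle_Y decomposition(1) by blast
    then show ?thesis by (rule that[OF _ decomposition(3,2,5,4,7,6)])
  qed
qed

subsection \<open>Full extensions of cousins\<close>

definition cousins_determined_by_order :: "'a graph \<Rightarrow> bool" where
  "cousins_determined_by_order K \<longleftrightarrow> (\<forall>G H. move\<^sup>*\<^sup>* K G \<longrightarrow> move\<^sup>*\<^sup>* K H \<longrightarrow>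
     card (verts G) = card (verts H) \<longrightarrow> graph_iso G H)"

definition full_extension :: "'a set \<Rightarrow> 'a graph \<Rightarrow> 'a graph \<Rightarrow> bool" where
  "full_extension S G H \<longleftrightarrow>
     marked_graph S G \<and> (\<exists>f. f \<notin> verts G \<and> marked_iso S (add_star f S G) H)"

lemma full_extension_marked_iso_iff:
  assumes "full_extension S G H" "full_extension S G' H'"
  shows "marked_iso S G G' \<longleftrightarrow> marked_iso S H H'"
proof -
  obtain f where f: "marked_graph S G" "f \<notin> verts G" and ext_H: "marked_iso S (add_star f S G) H"
    using assms(1) by (auto simp: full_extension_def)
  obtain g where g: "marked_graph S G'" "g \<notin> verts G'"
    and ext_H': "marked_iso S (add_star g S G') H'"
    using assms(2) by (auto simp: full_extension_def)
  have "marked_iso S G G' \<longleftrightarrow> marked_iso S (add_star f S G) (add_star g S G')"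
    using marked_iso_add_star[OF _ f(2) g(2)] marked_iso_add_star_cancel[OF f g] by blast
  also have "\<dots> \<longleftrightarrow> marked_iso S H H'"
    using ext_H ext_H' by (meson marked_iso_sym marked_iso_trans)
  finally show ?thesis .
qed

lemma card_verts_full_extension:
  assumes "full_extension S G H"
  shows "card (verts H) = Suc (card (verts G))"
proof -
  obtain f where f: "f \<notin> verts G" "marked_iso S (add_star f S G) H" and "finite (verts G)"
    using assms by (auto simp: full_extension_def marked_graph_def simple_graph_def)
  then show ?thesis using card_verts_graph_iso[OF marked_iso_imp_graph_iso[OF f(2)]] by simp
qed

locale framed_graph =
  fixes K :: "'a::infinite graph" and S :: "'a set" and n c :: nat
  assumes frame_K: "frame n c K S" and size: "n \<noteq> 3" and many_bridges: "4 \<le> c"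
begin

lemma marked_graph_K: "marked_graph S K"
  using frame_K by (simp add: frame_def)

lemma simple_K: "simple_graph K"
  using marked_graph_K by (simp add: marked_graph_def)

lemma frame_reachable_iff: "move\<^sup>*\<^sup>* K G \<Longrightarrow> frame n c G S' \<longleftrightarrow> frame n c K S'"
  by (rule fun_cong[OF frame_moves[OF _ simple_K size many_bridges]])

lemma frame_reachable: "move\<^sup>*\<^sup>* K G \<Longrightarrow> frame n c G S"
  using frame_reachable_iff[of G S] frame_K by simp

lemma marked_graph_reachable: "move\<^sup>*\<^sup>* K G \<Longrightarrow> marked_graph S G"
  using frame_reachable[of G] by (simp add: frame_def)

lemma graph_iso_imp_marked_iso:
  assumes unique: "\<And>S'. frame n c K S' \<Longrightarrow> S' = S"
    and "move\<^sup>*\<^sup>* K G" "move\<^sup>*\<^sup>* K H" "graph_iso G H"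
  shows "marked_iso S G H"
proof -
  obtain h where h: "inj_on h (verts G)" "H = map_graph h G"
    using assms(4) graph_iso_iff_map_graph by blast
  have "frame n c H (h ` S)"
    unfolding h(2) using frame_reachable[OF assms(2)] h(1) by (rule frame_map_graph)
  then have "h ` S = S" using unique frame_reachable_iff[OF assms(3)] by blast
  then show ?thesis
    unfolding h(2) by (rule marked_isoI[OF marked_graph_reachable[OF assms(2)] h(1)])
qed

lemma marked_cousin_add_star:
  assumes "move\<^sup>*\<^sup>* K G" "g \<notin> verts K" "f \<notin> verts G"
  shows "marked_cousin S (add_star g S K) (add_star f S G)"
  using assms(1,3)
proof (induction arbitrary: f)
  case base
  then show ?case
    unfolding marked_cousin_def
    using marked_iso_add_star[OF marked_iso_refl[OF marked_graph_K] assms(2)] by blast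
next
  case (step A B)
  have marked_A: "marked_graph S A" and marked_B: "marked_graph S B"
    using marked_graph_reachable rtranclp.rtrancl_into_rtrancl[OF step.hyps] step.hyps(1) by blast+
  then obtain e where e: "e \<notin> verts A" "e \<notin> verts B"
    using fresh_vertex unfolding marked_graph_def by blast
  have "move (add_star e S A) (add_star e S B)"
    by (rule move_add_star[OF marked_A e(1) marked_B e(2) step.hyps(2)])
  moreover have "S \<subseteq> verts (add_star e S B)" using marked_B by (auto simp: marked_graph_def)
  ultimately have "marked_cousin S (add_star g S K) (add_star e S B)"
    by (rule marked_cousin_move[OF step.IH[OF e(1)]])
  then show ?case
    by (rule marked_cousin_marked_iso[OF _
          marked_iso_add_star[OF marked_iso_refl[OF marked_B] e(2) step.prems]])
qed

lemma extend_reachableE: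
  assumes "move\<^sup>*\<^sup>* K G" "g \<notin> verts K"
  obtains H where "move\<^sup>*\<^sup>* (add_star g S K) H" "full_extension S G H"
proof -
  have G: "marked_graph S G" using marked_graph_reachable[OF assms(1)] .
  obtain f where f: "f \<notin> verts G" using fresh_vertex G unfolding marked_graph_def by blast
  obtain H where "move\<^sup>*\<^sup>* (add_star g S K) H" "marked_iso S H (add_star f S G)"
    using marked_cousin_add_star[OF assms f] by (auto simp: marked_cousin_def)
  then show ?thesis using that G f marked_iso_sym unfolding full_extension_def by blast
qed

end

locale full_extension_of_framed_graph = framed_graph K S n c
  for K :: "'a::infinite graph" and S :: "'a set" and n c :: nat +
  fixes g :: 'a and c' :: nat
  assumes new: "g \<notin> verts K"
    and frame_extended: "frame n c' (add_star g S K) S" and many_bridges_extended: "4 \<le> c'"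
    and few_edges: "card (edges (add_star g S K)) < c' * (n + 1)"
begin

sublocale extended: framed_graph "add_star g S K" S n c'
  by unfold_locales (rule frame_extended size many_bridges_extended)+

lemma reachable_extended:
  assumes "move\<^sup>*\<^sup>* (add_star g S K) H"
  shows "\<exists>f G. marked_cousin S K G \<and> f \<notin> verts G \<and> H = add_star f S G"
  using assms
proof induction
  case base
  then show ?case using marked_cousin_refl[OF marked_graph_K] new by blast
next
  case (step A B)
  have "frame n c' B S"
    by (rule extended.frame_reachable[OF rtranclp.rtrancl_into_rtrancl[OF step.hyps]])
  moreover have "card (edges A) < c' * (n + 1)"
    using few_edges card_edges_moves[OF step.hyps(1) extended.simple_K] by simp
  ultimately obtain e A' B' where move': "move A' B'"
      and A': "marked_graph S A'" "e \<notin> verts A'" "A = add_star e S A'"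
      and B': "marked_graph S B'" "e \<notin> verts B'" "B = add_star e S B'"
    using move_full_vertexE[OF step.hyps(2) extended.frame_reachable[OF step.hyps(1)] _ size]
    by metis
  obtain f G where G: "marked_cousin S K G" "f \<notin> verts G" "A = add_star f S G"
    using step.IH by blast
  have marked_G: "marked_graph S G" using marked_cousin_imp_marked_graph[OF G(1)] .
  have "marked_iso S (add_star f S G) (add_star e S A')"
    using marked_iso_refl[OF marked_graph_add_star[OF marked_G G(2)]] A'(3) G(3) by simp
  then have "marked_iso S G A'" by (rule marked_iso_add_star_cancel[OF marked_G G(2) A'(1,2)])
  then have "marked_cousin S K B'"
    using marked_cousin_move[OF marked_cousin_marked_iso[OF G(1)] move'] B'(1)
    by (auto simp: marked_graph_def)
  then show ?case using B'(2,3) by blast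
qed

lemma restrict_reachableE:
  assumes "move\<^sup>*\<^sup>* (add_star g S K) H"
  obtains G where "move\<^sup>*\<^sup>* K G" "full_extension S G H"
proof -
  obtain f G' where G': "marked_cousin S K G'" "f \<notin> verts G'" "H = add_star f S G'"
    using reachable_extended[OF assms] by blast
  then obtain G where G: "move\<^sup>*\<^sup>* K G" "marked_iso S G G'" by (auto simp: marked_cousin_def)
  have marked_G: "marked_graph S G" using marked_graph_reachable[OF G(1)] .
  then obtain e where e: "e \<notin> verts G" using fresh_vertex unfolding marked_graph_def by blast
  have "marked_iso S (add_star e S G) H"
    unfolding G'(3) using G(2) e G'(2) by (rule marked_iso_add_star)
  then show ?thesis using that[OF G(1)] marked_G e unfolding full_extension_def by blast
qed

text \<open>The alternative in the second assumption is for the case that an isomorphism between cousins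
  of \<open>K\<close> may move \<open>S\<close>.\<close>

lemma graph_iso_full_extension_iff:
  assumes unique_extended: "\<And>S'. frame n c' (add_star g S K) S' \<Longrightarrow> S' = S"
    and unique: "(\<forall>S'. frame n c K S' \<longrightarrow> S' = S) \<or> cousins_determined_by_order (add_star g S K)"
    and G: "move\<^sup>*\<^sup>* K G" "move\<^sup>*\<^sup>* K G'"
    and H: "move\<^sup>*\<^sup>* (add_star g S K) H" "move\<^sup>*\<^sup>* (add_star g S K) H'"
    and ext: "full_extension S G H" "full_extension S G' H'"
  shows "graph_iso G G' \<longleftrightarrow> graph_iso H H'"
proof
  assume iso: "graph_iso G G'"
  have "card (verts H) = card (verts H')"
    using card_verts_graph_iso[OF iso] card_verts_full_extension[OF ext(1)]
      card_verts_full_extension[OF ext(2)] by simp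
  with unique H consider "\<And>S'. frame n c K S' \<Longrightarrow> S' = S" | "graph_iso H H'"
    unfolding cousins_determined_by_order_def by blast
  then show "graph_iso H H'"
  proof cases
    assume "\<And>S'. frame n c K S' \<Longrightarrow> S' = S"
    then have "marked_iso S G G'" by (rule graph_iso_imp_marked_iso[OF _ G iso])
    then show ?thesis using full_extension_marked_iso_iff[OF ext] marked_iso_imp_graph_iso by blast
  qed
next
  assume "graph_iso H H'"
  with unique_extended H have "marked_iso S H H'" by (rule extended.graph_iso_imp_marked_iso)
  then show "graph_iso G G'"
    using full_extension_marked_iso_iff[OF ext] marked_iso_imp_graph_iso by blast
qed

end

subsection \<open>Counting isomorphism classes\<close>

lemma card_image_eq_if_rel:
  assumes "\<And>x. x \<in> A \<Longrightarrow> \<exists>y\<in>B. R x y" "\<And>y. y \<in> B \<Longrightarrow> \<exists>x\<in>A. R x y"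
    and f_iff_g: "\<And>x x' y y'. x \<in> A \<Longrightarrow> x' \<in> A \<Longrightarrow> y \<in> B \<Longrightarrow> y' \<in> B \<Longrightarrow> R x y \<Longrightarrow> R x' y' \<Longrightarrow>
      f x = f x' \<longleftrightarrow> g y = g y'"
  shows "card (f ` A) = card (g ` B)"
proof -
  obtain s where s: "\<And>x. x \<in> A \<Longrightarrow> s x \<in> B \<and> R x (s x)" using assms(1) by metis
  define F where "F u = g (s (inv_into A f u))" for u
  have F: "F (f x) = g y" if "x \<in> A" "y \<in> B" "R x y" for x y
  proof -
    have "inv_into A f (f x) \<in> A" "f (inv_into A f (f x)) = f x"
      using that(1) by (auto intro: inv_into_into f_inv_into_f)
    then show ?thesis using that s f_iff_g unfolding F_def by metis
  qed
  have "inj_on F (f ` A)"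
  proof (rule inj_onI)
    fix u u' assume "u \<in> f ` A" "u' \<in> f ` A" and F_eq: "F u = F u'"
    then obtain x x' where x: "x \<in> A" "u = f x" "x' \<in> A" "u' = f x'" by blast
    then have "g (s x) = g (s x')" using F_eq F[of x "s x"] F[of x' "s x'"] s by simp
    then show "u = u'" using x s f_iff_g[of x x' "s x" "s x'"] by simp
  qed
  moreover have "F ` f ` A = g ` B"
  proof (intro equalityI subsetI)
    fix u assume "u \<in> F ` f ` A"
    then obtain x where "x \<in> A" "u = F (f x)" by blast
    then show "u \<in> g ` B" using F s by blast
  next
    fix u assume "u \<in> g ` B"
    then obtain x y where x: "x \<in> A" "y \<in> B" "R x y" "u = g y" using assms(2) by blast
    have "u = F (f x)" using F[OF x(1-3)] x(4) by simp
    then show "u \<in> F ` f ` A" using x(1) by blast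
  qed
  ultimately show ?thesis using card_image by fastforce
qed

definition iso_class :: "nat graph \<Rightarrow> nat graph set" where
  "iso_class G = iso_rel `` {G}"

lemma iso_class_eq_iff:
  assumes "simple_graph G" "simple_graph H"
  shows "iso_class G = iso_class H \<longleftrightarrow> graph_iso G H"
proof -
  have "iso_class G = iso_class H \<longleftrightarrow> (G, H) \<in> iso_rel"
    unfolding iso_class_def using assms by (intro eq_equiv_class_iff[OF iso_rel_equiv]) auto
  then show ?thesis using assms by (simp add: iso_rel_def)
qed

lemma family_eq_iso_classes:
  assumes "simple_graph K"
  shows "family K = iso_class ` {G. move\<^sup>*\<^sup>* K G}"
proof (intro equalityI subsetI)
  fix C assume "C \<in> family K"
  then obtain G H where G: "move\<^sup>*\<^sup>* K G" "graph_iso G H" and H: "simple_graph H" "C = iso_class H"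
    by (auto simp: family_def quotient_def cousin_def iso_class_def)
  then have "C = iso_class G" using iso_class_eq_iff[OF simple_moves[OF G(1) assms] H(1)] by simp
  then show "C \<in> iso_class ` {G. move\<^sup>*\<^sup>* K G}" using G(1) by blast
next
  fix C assume "C \<in> iso_class ` {G. move\<^sup>*\<^sup>* K G}"
  then obtain G where G: "move\<^sup>*\<^sup>* K G" "C = iso_class G" by blast
  have "graph_iso G G" using graph_iso_iff_map_graph[of G G] by (metis inj_on_id map_graph_id)
  then have "cousin K G" using G(1) unfolding cousin_def by blast
  then show "C \<in> family K"
    unfolding family_def G(2) iso_class_def
    using simple_moves[OF G(1) assms] by (intro quotientI) simp
qed

lemma card_family_add_star:
  fixes K :: "nat graph"
  assumes "full_extension_of_framed_graph K S n c g c'"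
    and unique_extended: "\<And>S'. frame n c' (add_star g S K) S' \<Longrightarrow> S' = S"
    and unique: "(\<forall>S'. frame n c K S' \<longrightarrow> S' = S) \<or> cousins_determined_by_order (add_star g S K)"
  shows "card (family K) = card (family (add_star g S K))"
proof -
  interpret full_extension_of_framed_graph K S n c g c' by (rule assms(1))
  have "card (iso_class ` {G. move\<^sup>*\<^sup>* K G}) = card (iso_class ` {H. move\<^sup>*\<^sup>* (add_star g S K) H})"
  proof (rule card_image_eq_if_rel[where R = "full_extension S"]; unfold mem_Collect_eq)
    show "\<exists>H\<in>{H. move\<^sup>*\<^sup>* (add_star g S K) H}. full_extension S G H" if "move\<^sup>*\<^sup>* K G" for G
      using extend_reachableE[OF that new] by blast
    show "\<exists>G\<in>{G. move\<^sup>*\<^sup>* K G}. full_extension S G H" if "move\<^sup>*\<^sup>* (add_star g S K) H" for H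
      using restrict_reachableE[OF that] by blast
  next
    fix G G' H H'
    assume G: "move\<^sup>*\<^sup>* K G" "move\<^sup>*\<^sup>* K G'"
      and H: "move\<^sup>*\<^sup>* (add_star g S K) H" "move\<^sup>*\<^sup>* (add_star g S K) H'"
      and "full_extension S G H" "full_extension S G' H'"
    then have "graph_iso G G' \<longleftrightarrow> graph_iso H H'"
      using graph_iso_full_extension_iff[OF unique_extended unique] by blast
    then show "iso_class G = iso_class G' \<longleftrightarrow> iso_class H = iso_class H'"
      using iso_class_eq_iff simple_moves[OF _ simple_K] simple_moves[OF _ extended.simple_K] G H
      by simp
  qed
  then show ?thesis by (simp add: family_eq_iso_classes simple_K extended.simple_K)
qed

subsection \<open>Complete tripartite graphs\<close>

definition part :: "nat \<Rightarrow> nat \<Rightarrow> nat \<Rightarrow> nat" where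
  "part a b i = (if i < a then 0 else if i < a + b then 1 else 2)"

lemma verts_complete_tripartite [simp]: "verts (complete_tripartite a b c) = {0..<a+b+c}"
  by (simp add: complete_tripartite_def)

lemma edge_complete_tripartite_iff:
  "{p, q} \<in> edges (complete_tripartite a b c) \<longleftrightarrow>
     p < a + b + c \<and> q < a + b + c \<and> part a b p \<noteq> part a b q"
proof -
  have pair: "{p, q} \<in> {{i, j} |i j. i \<in> I \<and> j \<in> J} \<longleftrightarrow> p \<in> I \<and> q \<in> J \<or> q \<in> I \<and> p \<in> J"
    for I J :: "nat set"
    by (auto simp: doubleton_eq_iff)
  show ?thesis
    unfolding complete_tripartite_def snd_conv Un_iff pair by (auto simp: part_def)
qed

lemma neighbours_complete_tripartite:
  "p < a + b + c \<Longrightarrow>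
    neighbours (complete_tripartite a b c) p = {q \<in> {0..<a+b+c}. part a b q \<noteq> part a b p}"
  by (auto simp: neighbours_def edge_complete_tripartite_iff)

lemma complete_tripartite_Suc:
  "complete_tripartite a b (Suc c) = add_star (a + b + c) {0..<a+b} (complete_tripartite a b c)"
proof (rule graph_eqI)
  show "simple_graph (add_star (a + b + c) {0..<a+b} (complete_tripartite a b c))"
    by (intro simple_add_star simple_complete_tripartite) auto
  show "verts (complete_tripartite a b (Suc c)) =
      verts (add_star (a + b + c) {0..<a+b} (complete_tripartite a b c))"
    by auto
  show "{p, q} \<in> edges (complete_tripartite a b (Suc c)) \<longleftrightarrow>
      {p, q} \<in> edges (add_star (a + b + c) {0..<a+b} (complete_tripartite a b c))" for p q
    unfolding edges_add_star Un_iff doubleton_in_star_iff edge_complete_tripartite_iff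
    by (auto simp: part_def less_Suc_eq split: if_splits)
qed (rule simple_complete_tripartite)

lemma card_edges_complete_tripartite:
  "card (edges (complete_tripartite a b c)) \<le> a * b + (a + b) * c"
proof (induction c)
  case 0
  have "edges (complete_tripartite a b 0) = (\<lambda>(i, j). {i, j}) ` ({0..<a} \<times> {a..<a+b})"
    unfolding complete_tripartite_def by fastforce
  then show ?case using card_image_le[of "{0..<a} \<times> {a..<a+b}" "\<lambda>(i, j). {i, j}"] by simp
next
  case (Suc c)
  have "card (edges (complete_tripartite a b (Suc c))) \<le>
      card (edges (complete_tripartite a b c)) + card (star (a + b + c) {0..<a+b})"
    unfolding complete_tripartite_Suc edges_add_star by (rule card_Un_le)
  also have "card (star (a + b + c) {0..<a+b}) \<le> a + b"
    unfolding star_def using card_image_le[of "{0..<a+b}"] by simp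
  finally show ?case using Suc.IH by simp
qed

lemma frame_complement:
  assumes simple_G: "simple_graph G" and P_subset: "P \<subseteq> verts G"
    and neighbours_P: "\<And>p. p \<in> P \<Longrightarrow> neighbours G p = verts G - P"
  shows "frame (card (verts G - P)) (card P) G (verts G - P)"
proof -
  let ?S = "verts G - P"
  have closed: "closed_off G ?S Q" if "Q \<subseteq> P" for Q
    using that P_subset neighbours_P by (auto simp: closed_off_def)
  have "{p} \<in> bridges G ?S" if "p \<in> P" for p
    using that closed[of "{p}"] neighbours_P by (auto simp: bridges_def)
  moreover have "\<exists>p\<in>P. Q = {p}" if bridge_Q: "Q \<in> bridges G ?S" for Q
  proof -
    obtain p where p: "p \<in> Q" "p \<in> P"
      using bridges_nonempty[OF bridge_Q] bridges_subset[OF bridge_Q] by blast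
    then have "Q = {p}" using bridges_minimal[OF bridge_Q closed, of "{p}"] by auto
    then show ?thesis using p(2) by blast
  qed
  ultimately have "bridges G ?S = (\<lambda>p. {p}) ` P" by blast
  then show ?thesis using simple_G by (auto simp: frame_def marked_graph_def card_image inj_on_def)
qed

lemma frame_complement_of_part:
  assumes P_iff: "\<And>i. i \<in> P \<longleftrightarrow> i < a + b + c \<and> part a b i = t" and S_eq: "S = {0..<a+b+c} - P"
  shows "frame (card S) (card P) (complete_tripartite a b c) S"
proof -
  let ?K = "complete_tripartite a b c"
  have S_complement: "S = verts ?K - P" by (simp add: S_eq)
  have "P \<subseteq> verts ?K" using P_iff by (simp add: subset_iff)
  moreover have "neighbours ?K p = verts ?K - P" if "p \<in> P" for p
    using that P_iff[of p] by (subst neighbours_complete_tripartite) (auto simp: P_iff)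
  ultimately show ?thesis
    unfolding S_complement by (rule frame_complement[OF simple_complete_tripartite])
qed

lemma frame_complete_tripartite_AB: "frame (a + b) c (complete_tripartite a b c) {0..<a+b}"
proof -
  have "frame (card {0..<a+b}) (card {a+b..<a+b+c}) (complete_tripartite a b c) {0..<a+b}"
    by (rule frame_complement_of_part[where t = 2]) (auto simp: part_def)
  then show ?thesis by simp
qed

lemma frame_complete_tripartite_AC:
  "frame (a + c) b (complete_tripartite a b c) ({0..<a} \<union> {a+b..<a+b+c})"
proof -
  have "frame (card ({0..<a} \<union> {a+b..<a+b+c})) (card {a..<a+b}) (complete_tripartite a b c)
      ({0..<a} \<union> {a+b..<a+b+c})"
    by (rule frame_complement_of_part[where t = 1]) (auto simp: part_def)
  moreover have "card ({0..<a} \<union> {a+b..<a+b+c}) = a + c" by (subst card_Un_disjoint) auto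
  ultimately show ?thesis by simp
qed

lemma frame_complete_tripartite_within_part:
  assumes frame: "frame n k (complete_tripartite a b c) S" and "2 \<le> k"
  obtains t where "{0..<a+b+c} - S \<subseteq> {i \<in> {0..<a+b+c}. part a b i = t}"
proof -
  let ?K = "complete_tripartite a b c"
  have "\<not> card (bridges ?K S) \<le> Suc 0" using frame assms(2) by (simp add: frame_def)
  then obtain Q R where bridge_Q: "Q \<in> bridges ?K S" and bridge_R: "R \<in> bridges ?K S" and "Q \<noteq> R"
    using finite_bridges[OF simple_complete_tripartite] by (auto simp: card_le_Suc0_iff_eq)
  have disj: "Q \<inter> R = {}" using bridges_disjoint[OF bridge_Q bridge_R \<open>Q \<noteq> R\<close>] .
  obtain q r where qr: "q \<in> Q" "r \<in> R"
    using bridges_nonempty[OF bridge_Q] bridges_nonempty[OF bridge_R] by blast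
  have qr_bounds: "q < a + b + c" "r < a + b + c" "q \<notin> S" "r \<notin> S"
    using qr bridges_subset[OF bridge_Q] bridges_subset[OF bridge_R] by auto
  have neighbours_q: "neighbours ?K q \<subseteq> Q \<union> S" and neighbours_r: "neighbours ?K r \<subseteq> R \<union> S"
    using closed_off_neighbours[OF bridges_closed_off[OF bridge_Q] qr(1)]
      closed_off_neighbours[OF bridges_closed_off[OF bridge_R] qr(2)] .
  have same_part: "part a b r = part a b q"
    using neighbours_q qr_bounds disj qr neighbours_complete_tripartite[OF qr_bounds(1)] by auto
  have "part a b u = part a b q" if u_in: "u < a + b + c" "u \<notin> S" for u
  proof (rule ccontr)
    assume "part a b u \<noteq> part a b q"
    then have "u \<in> neighbours ?K q" "u \<in> neighbours ?K r"
      using u_in(1) same_part neighbours_complete_tripartite[OF qr_bounds(1)]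
        neighbours_complete_tripartite[OF qr_bounds(2)]
      by auto
    then show False using neighbours_q neighbours_r u_in(2) disj by blast
  qed
  then have "{0..<a+b+c} - S \<subseteq> {i \<in> {0..<a+b+c}. part a b i = part a b q}" by auto
  then show ?thesis by (rule that)
qed

lemma frame_complete_tripartite_unique:
  assumes frame: "frame (a + b) c (complete_tripartite a b c) S"
    and c_bounds: "2 \<le> c" "a * b \<le> c" "\<not> (a = 1 \<and> c = b)" and ab_bounds: "1 \<le> a" "a \<le> b"
  shows "S = {0..<a+b}"
proof -
  let ?V = "{0..<a+b+c}"
  obtain t where within: "?V - S \<subseteq> {i \<in> ?V. part a b i = t}"
    using frame_complete_tripartite_within_part[OF frame c_bounds(1)] .
  have "S \<subseteq> ?V" "card S = a + b" using frame by (auto simp: frame_def marked_graph_def)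
  then have card_complement: "card (?V - S) = c" and complement: "?V - (?V - S) = S"
    by (auto simp: card_Diff_subset finite_subset)
  have "a + b \<le> i" if "i \<in> ?V - S" for i
  proof (rule ccontr)
    assume "\<not> a + b \<le> i"
    moreover have "part a b i = t" using within that by blast
    ultimately have "t = 0 \<or> t = 1" by (auto simp: part_def split: if_splits)
    then have "?V - S \<subseteq> {0..<a} \<or> ?V - S \<subseteq> {a..<a+b}"
      using within by (auto simp: part_def split: if_splits)
    then have "c \<le> b"
      using card_mono[of "{0..<a}" "?V - S"] card_mono[of "{a..<a+b}" "?V - S"] card_complement
        ab_bounds(2)
      by auto
    moreover have "b \<le> a * b" using ab_bounds by simp
    ultimately have "a * b = b" "c = b" using c_bounds(2) by linarith+
    then show False using ab_bounds c_bounds by auto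
  qed
  then have "?V - S \<subseteq> {a+b..<a+b+c}" by auto
  then have complement_eq: "?V - S = {a+b..<a+b+c}"
    using card_complement by (intro card_subset_eq) auto
  have "S = ?V - {a+b..<a+b+c}" using complement unfolding complement_eq by (rule sym)
  then show ?thesis by auto
qed

subsection \<open>Cousins obtained from triangle packings\<close>

context triangle_packing
begin

lemma triangle_replaced_not_new:
  assumes triangle_T: "triangle (replace_triangles G Y \<tau>) T" and y_new: "y \<in> Y"
  shows "y \<notin> T"
proof
  assume y_in_T: "y \<in> T"
  have "card (T - {y}) = 2" using triangle_T y_in_T by (simp add: triangle_def)
  then obtain p q where pq: "T - {y} = {p, q}" "p \<noteq> q" by (meson card_2_iff)
  then have "p \<in> T" "q \<in> T" "p \<noteq> y" "q \<noteq> y" by auto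
  then have "p \<in> \<tau> y" "q \<in> \<tau> y"
    using triangle_edge[OF triangle_T y_in_T] neighbours_replaced_new[OF y_new]
    by (auto simp: neighbours_def)
  moreover from this have "p \<notin> Y" "q \<notin> Y" using triangle_not_new[OF y_new] by blast+
  ultimately show False
    using triangle_edge[OF triangle_T \<open>p \<in> T\<close> \<open>q \<in> T\<close> pq(2)] edge_replaced_old_iff y_new by blast
qed

lemma triangle_replaced:
  assumes triangle_T: "triangle (replace_triangles G Y \<tau>) T"
  shows "triangle G T" "\<And>y. y \<in> Y \<Longrightarrow> [T]\<^bsup>2\<^esup> \<inter> [\<tau> y]\<^bsup>2\<^esup> = {}"
proof -
  have old_edge: "{p, q} \<in> edges G \<and> (\<forall>y\<in>Y. \<not> {p, q} \<subseteq> \<tau> y)" if "p \<in> T" "q \<in> T" "p \<noteq> q" for p q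
    using triangle_edge[OF triangle_T that] triangle_replaced_not_new[OF triangle_T] that
      edge_replaced_old_iff by blast
  then show "triangle G T" using triangle_T by (auto simp: triangle_def nsets_2_eq)
  show "[T]\<^bsup>2\<^esup> \<inter> [\<tau> y]\<^bsup>2\<^esup> = {}" if y_new: "y \<in> Y" for y
  proof (rule Int_emptyI)
    fix e assume "e \<in> [T]\<^bsup>2\<^esup>" "e \<in> [\<tau> y]\<^bsup>2\<^esup>"
    moreover from this obtain p q where "e = {p, q}" by (auto elim: nsets2_E)
    ultimately show False using old_edge[of p q] y_new by auto
  qed
qed

end

lemma replace_triangles_insert:
  assumes "v \<notin> Y" "T \<inter> Y = {}"
  shows "replace_triangles G (insert v Y) (\<tau>(v := T)) =
      replace_triangle (replace_triangles G Y \<tau>) v T"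
proof -
  have "star y (\<tau> y) \<inter> [T]\<^bsup>2\<^esup> = {}" if "y \<in> Y" for y
    using that assms(2) by (auto simp: star_def)
  moreover have "(\<tau>(v := T)) y = \<tau> y" if "y \<in> Y" for y using that assms(1) by auto
  ultimately show ?thesis by (auto simp: replace_triangles_def)
qed

lemma triangle_packing_insert:
  assumes packing: "triangle_packing G Y \<tau>"
    and packing_T: "triangle_packing (replace_triangles G Y \<tau>) {v} (\<lambda>_. T)"
  shows "triangle_packing G (insert v Y) (\<tau>(v := T))"
    and "replace_triangles G (insert v Y) (\<tau>(v := T)) =
      replace_triangle (replace_triangles G Y \<tau>) v T"
proof -
  interpret triangle_packing G Y \<tau> by (rule packing)
  have v_new: "v \<notin> verts G" "v \<notin> Y" and triangle_T: "triangle (replace_triangles G Y \<tau>) T"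
    using packing_T by (simp_all add: triangle_packing_singleton)
  have "[(\<tau>(v := T)) y]\<^bsup>2\<^esup> \<inter> [(\<tau>(v := T)) z]\<^bsup>2\<^esup> = {}"
    if "y \<in> insert v Y" "z \<in> insert v Y" "y \<noteq> z" for y z
    using that edge_disjoint[of y z] triangle_replaced(2)[OF triangle_T, of y]
      triangle_replaced(2)[OF triangle_T, of z]
    by (cases "y = v"; cases "z = v") (simp_all add: Int_commute)
  then show "triangle_packing G (insert v Y) (\<tau>(v := T))"
    using simple finite_new new triangles v_new triangle_replaced(1)[OF triangle_T]
    unfolding triangle_packing_def by simp
  show "replace_triangles G (insert v Y) (\<tau>(v := T)) =
      replace_triangle (replace_triangles G Y \<tau>) v T"
    using v_new(2) triangle_replaced_not_new[OF triangle_T]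
    by (intro replace_triangles_insert) auto
qed

lemma triangle_packing_remove:
  assumes packing: "triangle_packing G Y \<tau>" and v_in: "v \<in> Y"
  shows "triangle_packing G (Y - {v}) \<tau>"
    and "triangle_packing (replace_triangles G (Y - {v}) \<tau>) {v} (\<lambda>_. \<tau> v)"
    and "replace_triangles G Y \<tau> = replace_triangle (replace_triangles G (Y - {v}) \<tau>) v (\<tau> v)"
proof -
  interpret triangle_packing G Y \<tau> by (rule packing)
  show packing_removed: "triangle_packing G (Y - {v}) \<tau>"
    using simple finite_new new triangles edge_disjoint by unfold_locales auto
  have "{i, j} \<in> edges (replace_triangles G (Y - {v}) \<tau>)" if ij_in: "{i, j} \<in> [\<tau> v]\<^bsup>2\<^esup>" for i j
  proof -
    have "{i, j} \<in> edges G" using triangles[OF v_in] ij_in by (auto simp: triangle_def)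
    moreover have "\<not> {i, j} \<subseteq> \<tau> y" if "y \<in> Y - {v}" for y
    proof -
      have "{i, j} \<notin> [\<tau> y]\<^bsup>2\<^esup>" using edge_disjoint[OF v_in, of y] that ij_in by blast
      then show ?thesis using ij_in by auto
    qed
    moreover have "i \<notin> Y - {v}" "j \<notin> Y - {v}" using ij_in triangle_not_new[OF v_in] by auto
    ultimately show ?thesis
      by (simp add: triangle_packing.edge_replaced_old_iff[OF packing_removed])
  qed
  then have "triangle (replace_triangles G (Y - {v}) \<tau>) (\<tau> v)"
    using triangles[OF v_in] by (auto simp: triangle_def nsets_2_eq)
  then show "triangle_packing (replace_triangles G (Y - {v}) \<tau>) {v} (\<lambda>_. \<tau> v)"
    using triangle_packing.simple_replaced[OF packing_removed] new v_in
    by (auto simp: triangle_packing_singleton)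
  have "\<tau> v \<inter> (Y - {v}) = {}" using triangle_not_new[OF v_in] by blast
  from replace_triangles_insert[OF _ this, of v G \<tau>] v_in
  show "replace_triangles G Y \<tau> = replace_triangle (replace_triangles G (Y - {v}) \<tau>) v (\<tau> v)"
    by (simp add: insert_absorb)
qed

lemma triangle_Y_replace_trianglesD:
  assumes packing: "triangle_packing K Y \<tau>"
    and move_G: "simple_graph G" "triangle_Y G (replace_triangles K Y \<tau>)"
    and degrees: "\<And>v. v \<in> verts K \<Longrightarrow> card (neighbours (replace_triangles K Y \<tau>) v) \<noteq> 3"
  shows "\<exists>v\<in>Y. G = replace_triangles K (Y - {v}) \<tau>"
proof -
  obtain v T where packing_T: "triangle_packing G {v} (\<lambda>_. T)"
    and replaced_eq: "replace_triangles K Y \<tau> = replace_triangle G v T"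
    using move_G triangle_Y_iff by blast
  have neighbours_v: "neighbours (replace_triangles K Y \<tau>) v = T"
    unfolding replaced_eq by (rule triangle_packing.neighbours_replaced_new[OF packing_T]) simp
  moreover have "card T = 3" using packing_T by (simp add: triangle_packing_singleton triangle_def)
  moreover have "v \<in> verts K \<union> Y" using arg_cong[OF replaced_eq, of verts] by auto
  ultimately have v_in: "v \<in> Y" using degrees by auto
  have \<tau>_v: "\<tau> v = T"
    using neighbours_v triangle_packing.neighbours_replaced_new[OF packing v_in] by simp
  have "G = replace_triangles K (Y - {v}) \<tau>"
    using packing_T triangle_packing_remove(2)[OF packing v_in, unfolded \<tau>_v]
      trans[OF sym[OF replaced_eq] triangle_packing_remove(3)[OF packing v_in, unfolded \<tau>_v]]
    by (rule replace_triangles_inject)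
  then show ?thesis using v_in by blast
qed

lemma moves_imp_triangle_packing:
  assumes "move\<^sup>*\<^sup>* K G" and simple_K: "simple_graph K"
    and degrees: "\<And>H v. move\<^sup>*\<^sup>* K H \<Longrightarrow> v \<in> verts K \<Longrightarrow> card (neighbours H v) \<noteq> 3"
  shows "\<exists>Y \<tau>. triangle_packing K Y \<tau> \<and> G = replace_triangles K Y \<tau>"
  using assms(1)
proof induction
  case base
  have "triangle_packing K {} \<tau>" "replace_triangles K {} \<tau> = K" for \<tau>
    using simple_K by (simp_all add: triangle_packing_def replace_triangles_def)
  then show ?case by metis
next
  case (step A B)
  obtain Y \<tau> where packing: "triangle_packing K Y \<tau>" and A_eq: "A = replace_triangles K Y \<tau>"
    using step.IH by blast
  have simple_A: "simple_graph A" using simple_moves[OF step.hyps(1) simple_K] .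
  from simple_A step.hyps(2) show ?case
  proof (cases rule: move_cases)
    case triangle_Y
    then obtain v T where "triangle_packing A {v} (\<lambda>_. T)" "B = replace_triangle A v T"
      using triangle_Y_iff[OF simple_A] by blast
    then show ?thesis using triangle_packing_insert[OF packing] A_eq by metis
  next
    case Y_triangle
    then have "\<exists>v\<in>Y. B = replace_triangles K (Y - {v}) \<tau>"
      using triangle_Y_replace_trianglesD[OF packing simple_move[OF simple_A step.hyps(2)]]
        degrees[OF step.hyps(1)] A_eq by simp
    then show ?thesis using triangle_packing_remove(1)[OF packing] by blast
  qed
qed

lemma graph_iso_replace_triangles:
  assumes packing: "triangle_packing K Y \<tau>"
    and packing': "triangle_packing K Z \<sigma>" and bij_g: "bij_betw g Y Z"
    and h_automorphism: "inj_on h (verts K)" "map_graph h K = K"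
    and h_image: "\<And>y. y \<in> Y \<Longrightarrow> h ` \<tau> y = \<sigma> (g y)"
  shows "graph_iso (replace_triangles K Y \<tau>) (replace_triangles K Z \<sigma>)"
proof -
  interpret triangle_packing K Y \<tau> by (rule packing)
  define k where "k u = (if u \<in> Y then g u else h u)" for u
  have k_eq_h: "k u = h u" if "u \<in> verts K" for u using that new by (auto simp: k_def)
  have k_image_Y: "k ` Y = Z" "inj_on k Y"
    using bij_g by (auto simp: k_def bij_betw_def inj_on_def)
  have k_fixes_K: "map_graph k K = K"
    using map_graph_cong[OF simple k_eq_h] h_automorphism(2) by simp
  have inj_k: "inj_on k (verts K)" using h_automorphism(1) k_eq_h by (simp add: inj_on_def)
  have "\<sigma> (k y) = k ` \<tau> y" if y_in: "y \<in> Y" for y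
  proof -
    have "k ` \<tau> y = h ` \<tau> y" using k_eq_h triangle_subset[OF y_in] by (intro image_cong) auto
    then show ?thesis using h_image[OF y_in] y_in by (simp add: k_def)
  qed
  then have "map_graph k (replace_triangles K Y \<tau>) = replace_triangles K Z \<sigma>"
    using map_graph_replace_triangles[OF simple inj_k, of Y \<tau> \<sigma>] triangle_subset k_fixes_K
      k_image_Y(1) by simp
  moreover have "inj_on k (verts K \<union> Y)"
  proof -
    have "k ` verts K = verts K" using arg_cong[OF k_fixes_K, of verts] by simp
    then have "k ` verts K \<inter> k ` Y = {}"
      using k_image_Y(1) triangle_packing.new[OF packing'] by blast
    then show ?thesis using inj_k k_image_Y(2) by (auto simp: inj_on_Un)
  qed
  ultimately show ?thesis by (metis graph_iso_iff_map_graph verts_replace_triangles)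
qed

subsection \<open>The cousins of \<open>K_{1,b,c}\<close>\<close>

lemma degree_cousin_complete_tripartite_ge:
  assumes "move\<^sup>*\<^sup>* (complete_tripartite a b c) G" and v_in: "v < a + b + c"
    and "a + b \<noteq> 3" "a + c \<noteq> 3" "4 \<le> b" "4 \<le> c"
  shows "4 \<le> card (neighbours G v)"
proof (cases "v < a + b")
  case True
  have "frame (a + b) c G {0..<a+b}"
    unfolding frame_moves[OF assms(1) simple_complete_tripartite assms(3,6)]
    by (rule frame_complete_tripartite_AB)
  then show ?thesis using frame_degree[of "a + b" c G "{0..<a+b}" v] True assms(6) by simp
next
  case False
  have "frame (a + c) b G ({0..<a} \<union> {a+b..<a+b+c})"
    unfolding frame_moves[OF assms(1) simple_complete_tripartite assms(4,5)]
    by (rule frame_complete_tripartite_AC)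
  then show ?thesis
    using frame_degree[of "a + c" b G "{0..<a} \<union> {a+b..<a+b+c}" v] False v_in assms(5) by simp
qed

lemma triangle_complete_tripartite_1E:
  assumes triangle_T: "triangle (complete_tripartite 1 b c) T"
  obtains p q where "p \<in> {1..<1+b}" "q \<in> {1+b..<1+b+c}" "T = {0, p, q}"
proof -
  have T_subset: "T \<subseteq> {0..<1+b+c}"
    using triangle_subset_verts[OF simple_complete_tripartite triangle_T] by simp
  have "inj_on (part 1 b) T"
  proof (rule inj_onI, rule ccontr)
    fix i j assume "i \<in> T" "j \<in> T" "part 1 b i = part 1 b j" "i \<noteq> j"
    then show False
      using triangle_edge[OF triangle_T, of i j] by (simp add: edge_complete_tripartite_iff)
  qed
  then have "card (part 1 b ` T) = card {0, 1, 2 :: nat}"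
    using triangle_T by (simp add: card_image triangle_def)
  moreover have "part 1 b ` T \<subseteq> {0, 1, 2}" by (auto simp: part_def)
  ultimately have "part 1 b ` T = {0, 1, 2}" by (intro card_subset_eq) auto
  then have "0 \<in> part 1 b ` T" "1 \<in> part 1 b ` T" "2 \<in> part 1 b ` T" by simp_all
  then obtain i p q
    where representatives: "i \<in> T" "p \<in> T" "q \<in> T"
      "0 = part 1 b i" "1 = part 1 b p" "2 = part 1 b q"
    by (elim imageE) blast
  have i_eq: "i = 0" using representatives(4) by (simp add: part_def split: if_splits)
  have p_in: "p \<in> {1..<1+b}" using representatives(5) by (simp add: part_def split: if_splits)
  have q_in: "q \<in> {1+b..<1+b+c}"
    using representatives(6) subsetD[OF T_subset representatives(3)]
    by (simp add: part_def split: if_splits)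
  have "card {0, p, q} = card T" using p_in q_in triangle_T by (simp add: triangle_def)
  then have "{0, p, q} = T"
    using representatives(1-3) i_eq finite_subset[OF T_subset] by (intro card_subset_eq) simp_all
  then show ?thesis using that[OF p_in q_in] by simp
qed

lemma triangle_packing_complete_tripartite_1E:
  assumes "triangle_packing (complete_tripartite 1 b c) Y \<tau>"
  obtains \<beta> \<gamma> where "inj_on \<beta> Y" "\<beta> ` Y \<subseteq> {1..<1+b}" "inj_on \<gamma> Y" "\<gamma> ` Y \<subseteq> {1+b..<1+b+c}"
    "\<forall>y\<in>Y. \<tau> y = {0, \<beta> y, \<gamma> y}"
proof -
  interpret triangle_packing "complete_tripartite 1 b c" Y \<tau> by (rule assms)
  have "\<forall>y\<in>Y. \<exists>p q. p \<in> {1..<1+b} \<and> q \<in> {1+b..<1+b+c} \<and> \<tau> y = {0, p, q}"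
    using triangles triangle_complete_tripartite_1E by metis
  then obtain \<beta> \<gamma> where triangles_eq: "\<And>y. y \<in> Y \<Longrightarrow>
      \<beta> y \<in> {1..<1+b} \<and> \<gamma> y \<in> {1+b..<1+b+c} \<and> \<tau> y = {0, \<beta> y, \<gamma> y}"
    by metis
  have inj: "inj_on f Y" if "\<And>y. y \<in> Y \<Longrightarrow> f y \<in> \<tau> y - {0}" for f
  proof (rule inj_onI, rule ccontr)
    fix y z assume shared: "y \<in> Y" "z \<in> Y" "f y = f z" "y \<noteq> z"
    then have "{0, f y} \<in> [\<tau> y]\<^bsup>2\<^esup> \<inter> [\<tau> z]\<^bsup>2\<^esup>" using that[of y] that[of z] triangles_eq by auto
    then show False using edge_disjoint[OF shared(1,2,4)] by simp
  qed
  have "inj_on \<beta> Y" "inj_on \<gamma> Y" using triangles_eq by (intro inj; fastforce)+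
  then show ?thesis using that[of \<beta> \<gamma>] triangles_eq by blast
qed

lemma ex_permutation_extending:
  assumes "finite B" "inj_on f Y" "f ` Y \<subseteq> B" "inj_on g Y" "g ` Y \<subseteq> B"
  obtains \<pi> where "\<pi> permutes B" "\<forall>y\<in>Y. \<pi> (f y) = g y"
proof -
  have "card (B - f ` Y) = card (B - g ` Y)"
    using assms by (simp add: card_Diff_subset finite_subset card_image)
  then obtain k where k: "bij_betw k (B - f ` Y) (B - g ` Y)"
    using finite_same_card_bij assms(1) by blast
  define \<pi> where "\<pi> u = (if u \<in> f ` Y then g (inv_into Y f u) else if u \<in> B then k u else u)" for u
  have \<pi>f: "\<pi> (f y) = g y" if "y \<in> Y" for y using that assms(2) by (simp add: \<pi>_def)
  have "bij_betw \<pi> (f ` Y) (g ` Y)"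
    using \<pi>f assms(4) by (auto simp: bij_betw_def inj_on_def image_image)
  moreover have "bij_betw \<pi> (B - f ` Y) (B - g ` Y)"
    using k by (rule bij_betw_cong[THEN iffD1, rotated]) (simp add: \<pi>_def)
  ultimately have "bij_betw \<pi> (f ` Y \<union> (B - f ` Y)) (g ` Y \<union> (B - g ` Y))"
    by (rule bij_betw_combine) auto
  then have "bij_betw \<pi> B B" using assms(3,5) by (simp add: Un_absorb1)
  then have "\<pi> permutes B" using assms(3) by (intro bij_imp_permutes) (auto simp: \<pi>_def)
  then show ?thesis using that \<pi>f by blast
qed

lemma map_graph_complete_tripartite:
  assumes perm: "h permutes {0..<a+b+c}"
    and part: "\<And>i. i < a + b + c \<Longrightarrow> part a b (h i) = part a b i"
  shows "map_graph h (complete_tripartite a b c) = complete_tripartite a b c"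
proof (rule graph_eqI)
  let ?K = "complete_tripartite a b c"
  have inj_h: "inj_on h (verts ?K)" using permutes_inj_on[OF perm] .
  show "simple_graph (map_graph h ?K)"
    using simple_map_graph[OF simple_complete_tripartite inj_h] .
  show verts_eq: "verts (map_graph h ?K) = verts ?K" using permutes_image[OF perm] by simp
  show "{p, q} \<in> edges (map_graph h ?K) \<longleftrightarrow> {p, q} \<in> edges ?K" for p q
  proof (cases "p \<in> verts ?K \<and> q \<in> verts ?K")
    case True
    then have "p \<in> h ` {0..<a+b+c}" "q \<in> h ` {0..<a+b+c}" using permutes_image[OF perm] by simp_all
    then obtain i j where "i < a + b + c" "j < a + b + c" "p = h i" "q = h j" by auto
    then show ?thesis
      using edge_map_graph_iff[OF simple_complete_tripartite inj_h, of i j] True part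
      by (simp add: edge_complete_tripartite_iff)
  next
    case False
    then show ?thesis
      using simple_graphD(2,3)[OF \<open>simple_graph (map_graph h ?K)\<close>, of p q]
        simple_graphD(2,3)[OF simple_complete_tripartite, of p q a b c] verts_eq by blast
  qed
qed (rule simple_complete_tripartite)

lemma automorphism_complete_tripartite_1:
  assumes \<pi>: "\<pi> permutes {1..<1+b}" and \<rho>: "\<rho> permutes {1+b..<1+b+c}"
  obtains h where "h permutes {0..<1+b+c}"
    "map_graph h (complete_tripartite 1 b c) = complete_tripartite 1 b c"
    "h 0 = 0" "\<forall>i\<in>{1..<1+b}. h i = \<pi> i" "\<forall>i\<in>{1+b..<1+b+c}. h i = \<rho> i"
proof -
  let ?B = "{1..<1+b}" and ?C = "{1+b..<1+b+c}" and ?h = "\<pi> \<circ> \<rho>"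
  have perm: "?h permutes {0..<1+b+c}"
    using \<pi> \<rho> by (intro permutes_compose; elim permutes_subset) auto
  have h0: "?h 0 = 0" using permutes_not_in[OF \<pi>, of 0] permutes_not_in[OF \<rho>, of 0] by simp
  have hB: "?h i = \<pi> i" if "i \<in> ?B" for i using that permutes_not_in[OF \<rho>, of i] by simp
  have hC: "?h i = \<rho> i" if "i \<in> ?C" for i
    using permutes_in_image[OF \<rho>, of i] that permutes_not_in[OF \<pi>, of "\<rho> i"] by simp
  have "part 1 b (?h i) = part 1 b i" if "i < 1 + b + c" for i
  proof -
    have "i = 0 \<or> i \<in> ?B \<or> i \<in> ?C" using that by auto
    then consider (A) "i = 0" | (B) "i \<in> ?B" | (C) "i \<in> ?C" by blast
    then show ?thesis
    proof cases
      case A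
      then show ?thesis using h0 by simp
    next
      case B
      then show ?thesis using hB[OF B] permutes_in_image[OF \<pi>, of i] by (simp add: part_def)
    next
      case C
      then show ?thesis using hC[OF C] permutes_in_image[OF \<rho>, of i] by (simp add: part_def)
    qed
  qed
  then show ?thesis using that[OF perm map_graph_complete_tripartite[OF perm] h0] hB hC by blast
qed

lemma graph_iso_replace_triangles_complete_tripartite_1:
  assumes packing: "triangle_packing (complete_tripartite 1 b c) Y \<tau>"
    and packing': "triangle_packing (complete_tripartite 1 b c) Z \<sigma>" and card: "card Y = card Z"
  shows "graph_iso (replace_triangles (complete_tripartite 1 b c) Y \<tau>)
    (replace_triangles (complete_tripartite 1 b c) Z \<sigma>)"
proof -
  let ?B = "{1..<1+b}" and ?C = "{1+b..<1+b+c}"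
  obtain \<beta> \<gamma> where \<tau>: "inj_on \<beta> Y" "\<beta> ` Y \<subseteq> ?B" "inj_on \<gamma> Y" "\<gamma> ` Y \<subseteq> ?C"
      "\<forall>y\<in>Y. \<tau> y = {0, \<beta> y, \<gamma> y}"
    by (rule triangle_packing_complete_tripartite_1E[OF packing])
  obtain \<beta>' \<gamma>' where \<sigma>: "inj_on \<beta>' Z" "\<beta>' ` Z \<subseteq> ?B" "inj_on \<gamma>' Z" "\<gamma>' ` Z \<subseteq> ?C"
      "\<forall>z\<in>Z. \<sigma> z = {0, \<beta>' z, \<gamma>' z}"
    by (rule triangle_packing_complete_tripartite_1E[OF packing'])
  obtain g where bij_g: "bij_betw g Y Z"
    using finite_same_card_bij[OF _ _ card] triangle_packing.finite_new packing packing' by blast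
  then have g_image: "g ` Y = Z" "inj_on g Y" by (auto simp: bij_betw_def)
  have "inj_on (\<beta>' \<circ> g) Y" "(\<beta>' \<circ> g) ` Y \<subseteq> ?B" "inj_on (\<gamma>' \<circ> g) Y" "(\<gamma>' \<circ> g) ` Y \<subseteq> ?C"
    using \<sigma>(1-4) g_image by (auto intro: comp_inj_on)
  then obtain \<pi> \<rho> where \<pi>: "\<pi> permutes ?B" "\<forall>y\<in>Y. \<pi> (\<beta> y) = (\<beta>' \<circ> g) y"
    and \<rho>: "\<rho> permutes ?C" "\<forall>y\<in>Y. \<rho> (\<gamma> y) = (\<gamma>' \<circ> g) y"
    using ex_permutation_extending[OF finite_atLeastLessThan \<tau>(1,2)]
      ex_permutation_extending[OF finite_atLeastLessThan \<tau>(3,4)] by metis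
  obtain h where h: "h permutes {0..<1+b+c}"
      "map_graph h (complete_tripartite 1 b c) = complete_tripartite 1 b c" "h 0 = 0"
      "\<forall>i\<in>?B. h i = \<pi> i" "\<forall>i\<in>?C. h i = \<rho> i"
    by (rule automorphism_complete_tripartite_1[OF \<pi>(1) \<rho>(1)])
  show ?thesis
  proof (rule graph_iso_replace_triangles[OF packing packing' bij_g permutes_inj_on[OF h(1)] h(2)])
    fix y assume y_in: "y \<in> Y"
    have "h (\<beta> y) = \<beta>' (g y)" "h (\<gamma> y) = \<gamma>' (g y)"
      using y_in \<tau>(2,4) h(4,5) \<pi>(2) \<rho>(2) by (simp_all add: image_subset_iff)
    moreover have "g y \<in> Z" using y_in g_image(1) by blast
    ultimately show "h ` \<tau> y = \<sigma> (g y)" using y_in \<tau>(5) \<sigma>(5) h(3) by simp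
  qed
qed

lemma cousins_determined_by_order_complete_tripartite_1:
  assumes "4 \<le> b" "4 \<le> c"
  shows "cousins_determined_by_order (complete_tripartite 1 b c)"
  unfolding cousins_determined_by_order_def
proof (intro allI impI)
  let ?K = "complete_tripartite 1 b c"
  fix G H
  assume moves_G: "move\<^sup>*\<^sup>* ?K G" and moves_H: "move\<^sup>*\<^sup>* ?K H"
    and card: "card (verts G) = card (verts H)"
  have packing: "\<exists>Y \<tau>. triangle_packing ?K Y \<tau> \<and> A = replace_triangles ?K Y \<tau>"
    if moves_A: "move\<^sup>*\<^sup>* ?K A" for A
  proof (rule moves_imp_triangle_packing[OF moves_A simple_complete_tripartite])
    show "card (neighbours B v) \<noteq> 3" if "move\<^sup>*\<^sup>* ?K B" "v \<in> verts ?K" for B v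
      using degree_cousin_complete_tripartite_ge[OF that(1), of v] that(2) assms by simp
  qed
  have card_verts: "card (verts (replace_triangles ?K Y \<tau>)) = 1 + b + c + card Y"
    if "triangle_packing ?K Y \<tau>" for Y \<tau>
    using triangle_packing.new[OF that] triangle_packing.finite_new[OF that]
    by (simp add: card_Un_disjoint Int_commute)
  obtain Y \<tau> where packing_G: "triangle_packing ?K Y \<tau>" "G = replace_triangles ?K Y \<tau>"
    using packing[OF moves_G] by blast
  obtain Z \<sigma> where packing_H: "triangle_packing ?K Z \<sigma>" "H = replace_triangles ?K Z \<sigma>"
    using packing[OF moves_H] by blast
  have "card Y = card Z"
    using card card_verts[OF packing_G(1)] card_verts[OF packing_H(1)]
    by (simp add: packing_G(2) packing_H(2))
  then show "graph_iso G H"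
    unfolding packing_G(2) packing_H(2)
    by (rule graph_iso_replace_triangles_complete_tripartite_1[OF packing_G(1) packing_H(1)])
qed

subsection \<open>Stabilisation of the family\<close>

lemma card_family_complete_tripartite_Suc:
  assumes ab_bounds: "1 \<le> a" "a \<le> b" "(a, b) \<noteq> (1, 2)" and c_bounds: "4 \<le> c" "a * b \<le> c"
  shows "card (family (complete_tripartite a b c)) =
    card (family (complete_tripartite a b (Suc c)))"
proof -
  let ?K = "complete_tripartite a b c" and ?K' = "complete_tripartite a b (Suc c)"
  let ?S = "{0..<a+b}"
  note Suc = complete_tripartite_Suc[of a b c, symmetric]
  have "card (edges ?K') \<le> a * b + (a + b) * Suc c" by (rule card_edges_complete_tripartite)
  also have "\<dots> < Suc c * (a + b + 1)" using c_bounds(2) by (simp add: algebra_simps)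
  finally have "full_extension_of_framed_graph ?K ?S (a + b) c (a + b + c) (Suc c)"
    using ab_bounds c_bounds(1) frame_complete_tripartite_AB by unfold_locales (auto simp: Suc)
  moreover have "S' = ?S" if "frame (a + b) (Suc c) ?K' S'" for S'
  proof -
    have "b \<le> a * b" using ab_bounds(1) by simp
    then have "Suc c \<noteq> b" using c_bounds(2) by linarith
    then show ?thesis using frame_complete_tripartite_unique[OF that] c_bounds ab_bounds by simp
  qed
  moreover have "(\<forall>S'. frame (a + b) c ?K S' \<longrightarrow> S' = ?S) \<or>
      cousins_determined_by_order ?K'"
  proof (cases "a = 1 \<and> c = b")
    case True
    then show ?thesis
      using cousins_determined_by_order_complete_tripartite_1[of b "Suc c"] c_bounds(1) by simp
  next
    case False
    then show ?thesis using frame_complete_tripartite_unique[of a b c] c_bounds ab_bounds by auto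
  qed
  ultimately have "card (family ?K) = card (family (add_star (a + b + c) ?S ?K))"
    by (intro card_family_add_star) (simp_all add: Suc)
  then show ?thesis by (simp add: Suc)
qed

theorem theorem2:
  fixes a b c d :: nat
  assumes "1 \<le> a" and "a \<le> b" and "b \<le> c"
    and "(a, b) \<noteq> (1, 2)"
    and "d = max 4 (a * b)" and "c \<ge> d"
  shows "card (family (complete_tripartite a b c)) = card (family (complete_tripartite a b d))"
  using assms(6)
proof (induction rule: dec_induct)
  case (step n)
  then have "4 \<le> n" "a * b \<le> n" using assms(5) by auto
  then have "card (family (complete_tripartite a b n)) =
      card (family (complete_tripartite a b (Suc n)))"
    by (rule card_family_complete_tripartite_Suc[OF assms(1,2,4)])
  then show ?case using step.IH by simp
qed simp

end
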